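(* Let $n=16$ and $H=(\frac1{16},\ldots,\frac1{16})\in\{0,\frac12,\frac1{16}\}^{16}$. Then the $L(\frac12,0)^{\otimes 16}_{\mathcal{C}_{16}}$-submodule $W_{H,\mathcal{C}_{16}}$ of $W_H=L(\frac12,\frac1{16})^{\otimes 16}$ generated by $v_H=v_{1/16}\otimes\cdots\otimes v_{1/16}$, where $v_{1/16}$ spans the lowest conformal weight space of $L(\frac12,\frac1{16})$, is an integral form of the $L(\frac12,0)^{\otimes 16}$-module $W_H$.
   Context: Vertex operator algebras and modules are over $\mathbb{C}$, with the usual definitions. Write $Y(u,x)=\sum_{m\in\mathbb{Z}}u_m x^{-m-1}$. A vertex subring of $V$ is an additive subgroup containing $\mathbf 1$ and closed under all products $(u,v)\mapsto u_mv$, $m\in\mathbb{Z}$. An integral form of a vertex operator algebra $V$ is a vertex subring $V_\mathbb{Z}$ which is the $\mathbb{Z}$-span of a $\mathbb{C}$-basis of $V$ and is compatible with the conformal weight grading ($V_\mathbb{Z}=\coprod_m V_{(m)}\cap V_\mathbb{Z}$). An integral form of a $V$-module $W$ (with respect to $V_\mathbb{Z}$) is an additive subgroup $W_\mathbb{Z}\subseteq W$ closed under all $u_m$, $u\in V_\mathbb{Z}$, $m\in\mathbb{Z}$, which is the $\mathbb{Z}$-span of a $\mathbb{C}$-basis of $W$ and satisfies $W_\mathbb{Z}=\coprod_{h\in\mathbb{C}}W_{(h)}\cap W_\mathbb{Z}$, where $W_{(h)}$ is the $L(0)$-eigenspace of eigenvalue $h$. The $V_\mathbb{Z}$-submodule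 generated by a vector is the smallest additive subgroup containing it and closed under all $u_m$, $u\in V_\mathbb{Z}$. $L(\ell,h)$ is the irreducible lowest weight module for the Virasoro algebra of central charge $\ell$ and lowest conformal weight $h$. $L(\frac12,0)$ is the simple Virasoro vertex operator algebra of central charge $\frac12$, with irreducible modules $L(\frac12,h)$, $h\in\{0,\frac12,\frac1{16}\}$. $L(\frac12,0)^{\otimes 16}$ is the usual tensor product vertex operator algebra. For a finite set, its power set is an $\mathbb{F}_2$-vector space under symmetric difference, and a binary linear code is an $\mathbb{F}_2$-subspace. The Hamming code $\mathcal{H}$ on $\Omega=\{1,\ldots,8\}$ consists of the sets $\emptyset$, $\{1,2,3,4\}$, $\{1,2,5,6\}$, $\{1,2,7,8\}$, $\{1,3,5,7\}$, $\{2,4,5,7\}$, $\{2,3,6,7\}$, $\{2,3,5,8\}$ and their complements in $\Omega$. Let $\Omega'=\{1',\ldots,8'\}$ be a disjoint copy of $\Omega$, and for $T\subseteq\Omega$ let $T'\subseteq\Omega'$ be the corresponding set. $\mathcal{C}_{16}$ is the code in $P(\Omega\cup\Omega')$ spanned over $\mathbb{F}_2$ by $\Omega'$ and the sets $T\cup T'$, $T\in\mathcal{H}$; it consists of the 32 sets $T\cup T'$ and $T\cup(T')^c$, $T\in\mathcal{H}$, where $(T')^c=\Omega'\setminus T'$. Identify $\Omega\cup\Omega'$ with the set of indices of the 16 tensor factors of $L(\frac12,0)^{\otimes 16}$. For an index $i$, $\omega^{(i)}$ has the conformal vector of $L(\frac12,0)$ in the $i$-th tensor factor and $\mathbf 1$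 elsewhere; for a set $T$ of indices, $\omega_T=\sum_{i\notin T}\omega^{(i)}-\sum_{i\in T}\omega^{(i)}$. $L(\frac12,0)^{\otimes 16}_{\mathcal{C}_{16}}$ is the vertex subring of $L(\frac12,0)^{\otimes 16}$ generated by all $\omega_T$, $T\in\mathcal{C}_{16}$; it is an integral form of $L(\frac12,0)^{\otimes 16}$. *)

theory Defs
  imports
    Complex_Main
    "HOL-Library.Groups_Big_Fun"
    "HOL-Library.FuncSet"
    "HOL-Library.Numeral_Type"
begin

text \<open>
  A complex vector space is a type of class \<open>ab_group_add\<close> together with a scaling \<open>s\<close> satisfying
  \<open>vector_space s\<close>. A vertex operator map \<open>Y(u,x) = \<Sum>m. u_m x^(-m-1)\<close> is given by its modes
  \<open>Y u m = u_m\<close>, with \<open>m\<close> an integer. Formally infinite sums which have only finitely many nonzero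
  terms (by lower truncation) are written with \<^const>\<open>Sum_any\<close>.
\<close>

section \<open>Linear algebra\<close>

definition is_basis :: "(complex \<Rightarrow> 'a::ab_group_add \<Rightarrow> 'a) \<Rightarrow> 'a set \<Rightarrow> bool" where
  "is_basis s B \<longleftrightarrow> \<not> module.dependent s B \<and> module.span s B = UNIV"

definition int_span :: "(complex \<Rightarrow> 'a::ab_group_add \<Rightarrow> 'a) \<Rightarrow> 'a set \<Rightarrow> 'a set" where
  "int_span s B = {\<Sum>b\<in>F. s (of_int (k b)) b | F (k :: 'a \<Rightarrow> int). finite F \<and> F \<subseteq> B}"

definition add_subgroup :: "'a::ab_group_add set \<Rightarrow> bool" where
  "add_subgroup A \<longleftrightarrow> 0 \<in> A \<and> (\<forall>x\<in>A. \<forall>y\<in>A. x + y \<in> A) \<and> (\<forall>x\<in>A. - x \<in> A)"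

text \<open>\<open>A\<close> is the internal direct sum of the subgroups \<open>F i\<close>: summation is a bijection from the
  finitely supported families \<open>f\<close> with \<open>f i \<in> F i\<close> onto \<open>A\<close>.\<close>

definition internal_direct_sum :: "('i \<Rightarrow> 'a::ab_group_add set) \<Rightarrow> 'a set \<Rightarrow> bool" where
  "internal_direct_sum F A \<longleftrightarrow>
     bij_betw Sum_any {f. finite {i. f i \<noteq> 0} \<and> (\<forall>i. f i \<in> F i)} A"

section \<open>Virasoro modules\<close>

definition virasoro_relations ::
  "(complex \<Rightarrow> 'a::ab_group_add \<Rightarrow> 'a) \<Rightarrow> complex \<Rightarrow> (int \<Rightarrow> 'a \<Rightarrow> 'a) \<Rightarrow> bool" where
  "virasoro_relations s c L \<longleftrightarrow>
     (\<forall>n. Vector_Spaces.linear s s (L n)) \<and>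
     (\<forall>m n v. L m (L n v) - L n (L m v) =
        s (of_int (m - n)) (L (m + n) v) +
        (if m + n = 0 then s (of_int (m ^ 3 - m) / 12 * c) v else 0))"

definition virasoro_submodule ::
  "(complex \<Rightarrow> 'a::ab_group_add \<Rightarrow> 'a) \<Rightarrow> (int \<Rightarrow> 'a \<Rightarrow> 'a) \<Rightarrow> 'a set \<Rightarrow> bool" where
  "virasoro_submodule s L U \<longleftrightarrow> module.subspace s U \<and> (\<forall>n. \<forall>u\<in>U. L n u \<in> U)"

text \<open>The operators \<open>L n\<close> make the whole space into a copy of the irreducible lowest weight module
  \<open>L(c, h)\<close>; these conditions determine it up to isomorphism.\<close>

definition irreducible_lowest_weight ::
  "(complex \<Rightarrow> 'a::ab_group_add \<Rightarrow> 'a) \<Rightarrow> complex \<Rightarrow> complex \<Rightarrow> (int \<Rightarrow> 'a \<Rightarrow> 'a) \<Rightarrow> bool" where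
  "irreducible_lowest_weight s c h L \<longleftrightarrow>
     vector_space s \<and> virasoro_relations s c L \<and>
     (\<exists>v. v \<noteq> 0 \<and> (\<forall>n>0. L n v = 0) \<and> L 0 v = s h v \<and>
          virasoro_submodule s L hull {v} = UNIV) \<and>
     (\<forall>U. virasoro_submodule s L U \<longrightarrow> U = {0} \<or> U = UNIV)"

section \<open>Vertex operator algebras and modules\<close>

text \<open>The components of the Jacobi identity (the coefficients of
  \<open>x0^(-r-1) x1^(-p-1) x2^(-q-1)\<close>), also known as the Borcherds identity.\<close>

definition jacobi_identity ::
  "(complex \<Rightarrow> 'w::ab_group_add \<Rightarrow> 'w) \<Rightarrow> ('v \<Rightarrow> int \<Rightarrow> 'v \<Rightarrow> 'v) \<Rightarrow> ('v \<Rightarrow> int \<Rightarrow> 'w \<Rightarrow> 'w) \<Rightarrow> bool" where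
  "jacobi_identity s YV YW \<longleftrightarrow> (\<forall>u v w p q r.
     Sum_any (\<lambda>i::nat. s (of_int p gchoose i) (YW (YV u (r + int i) v) (p + q - int i) w)) =
     Sum_any (\<lambda>i::nat. s ((-1) ^ i * (of_int r gchoose i))
       (YW u (p + r - int i) (YW v (q + int i) w)
        - s ((-1) powi r) (YW v (q + r - int i) (YW u (p + int i) w)))))"

definition virasoro_op :: "('v \<Rightarrow> int \<Rightarrow> 'w \<Rightarrow> 'w) \<Rightarrow> 'v \<Rightarrow> int \<Rightarrow> 'w \<Rightarrow> 'w" where
  "virasoro_op Y conf n = Y conf (n + 1)"

definition weight_space ::
  "(complex \<Rightarrow> 'w \<Rightarrow> 'w) \<Rightarrow> ('v \<Rightarrow> int \<Rightarrow> 'w \<Rightarrow> 'w) \<Rightarrow> 'v \<Rightarrow> complex \<Rightarrow> 'w set" where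
  "weight_space s Y conf h = {w. virasoro_op Y conf 0 w = s h w}"

locale voa = vector_space scale
  for scale :: "complex \<Rightarrow> 'v::ab_group_add \<Rightarrow> 'v" +
  fixes Y :: "'v \<Rightarrow> int \<Rightarrow> 'v \<Rightarrow> 'v"
    and vac conf :: 'v
    and c :: complex
  assumes linear_left: "Vector_Spaces.linear scale scale (\<lambda>u. Y u m v)"
    and linear_right: "Vector_Spaces.linear scale scale (Y u m)"
    and truncation: "\<exists>N. \<forall>m\<ge>N. Y u m v = 0"
    and vacuum: "Y vac m v = (if m = -1 then v else 0)"
    and creation: "m \<ge> 0 \<Longrightarrow> Y v m vac = 0" "Y v (-1) vac = v"
    and jacobi: "jacobi_identity scale Y Y"
    and virasoro: "virasoro_relations scale c (virasoro_op Y conf)"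
    and derivative: "Y (virasoro_op Y conf (-1) v) m w = scale (- of_int m) (Y v (m - 1) w)"
    and grading: "internal_direct_sum (\<lambda>n::int. weight_space scale Y conf (of_int n)) UNIV"
    and finite_dim: "\<exists>B. finite B \<and> weight_space scale Y conf (of_int n) \<subseteq> span B"
    and lower_bound: "\<exists>N. \<forall>n<N. weight_space scale Y conf (of_int n) = {0}"

locale voa_module = V: voa sV YV vac conf c + W: vector_space sW
  for sV :: "complex \<Rightarrow> 'v::ab_group_add \<Rightarrow> 'v" and YV vac conf c
    and sW :: "complex \<Rightarrow> 'w::ab_group_add \<Rightarrow> 'w" +
  fixes YW :: "'v \<Rightarrow> int \<Rightarrow> 'w \<Rightarrow> 'w"
  assumes linear_left: "Vector_Spaces.linear sV sW (\<lambda>u. YW u m w)"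
    and linear_right: "Vector_Spaces.linear sW sW (YW u m)"
    and truncation: "\<exists>N. \<forall>m\<ge>N. YW u m w = 0"
    and vacuum: "YW vac m w = (if m = -1 then w else 0)"
    and jacobi: "jacobi_identity sW YV YW"
    and virasoro: "virasoro_relations sW c (virasoro_op YW conf)"
    and derivative: "YW (virasoro_op YV conf (-1) v) m w = sW (- of_int m) (YW v (m - 1) w)"
    and grading: "internal_direct_sum (weight_space sW YW conf) UNIV"
    and finite_dim: "\<exists>B. finite B \<and> weight_space sW YW conf h \<subseteq> W.span B"
    and lower_bound: "\<exists>N::int. \<forall>n<N. weight_space sW YW conf (h + of_int n) = {0}"

section \<open>Tensor powers\<close>

text \<open>\<open>\<tau>\<close> exhibits its codomain as the tensor power of its factor indexed by \<open>'i\<close>, \<open>\<tau> f\<close> being the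
  pure tensor with \<open>i\<close>-th factor \<open>f i\<close>.\<close>

definition is_tensor_power ::
  "(complex \<Rightarrow> 'a::ab_group_add \<Rightarrow> 'a) \<Rightarrow> (complex \<Rightarrow> 'b::ab_group_add \<Rightarrow> 'b) \<Rightarrow>
   (('i::finite \<Rightarrow> 'a) \<Rightarrow> 'b) \<Rightarrow> bool" where
  "is_tensor_power sA sT \<tau> \<longleftrightarrow>
     (\<forall>f i. Vector_Spaces.linear sA sT (\<lambda>x. \<tau> (f(i := x)))) \<and>
     (\<forall>B. is_basis sA B \<longrightarrow> inj_on \<tau> (UNIV \<rightarrow> B) \<and> is_basis sT (\<tau> ` (UNIV \<rightarrow> B)))"

text \<open>\<open>Y(\<otimes>u, x) (\<otimes>w) = \<otimes> Y(u i, x) (w i)\<close> on pure tensors: collecting the monomials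
  \<open>x^(-k i - 1)\<close>, the coefficient of \<open>x^(-m-1)\<close> comes from the families of modes \<open>k\<close> with
  \<open>\<Sum>i. k i + 1 = m + 1\<close>.\<close>

definition tensor_modes ::
  "(('i::finite \<Rightarrow> 'v) \<Rightarrow> 't) \<Rightarrow> (('i \<Rightarrow> 'w) \<Rightarrow> 'u::ab_group_add) \<Rightarrow>
   ('v \<Rightarrow> int \<Rightarrow> 'w \<Rightarrow> 'w) \<Rightarrow> ('t \<Rightarrow> int \<Rightarrow> 'u \<Rightarrow> 'u) \<Rightarrow> bool" where
  "tensor_modes \<tau>V \<tau>W Y YT \<longleftrightarrow> (\<forall>u m w. YT (\<tau>V u) m (\<tau>W w) =
     Sum_any (\<lambda>k :: 'i \<Rightarrow> int.
       if (\<Sum>i\<in>UNIV. k i + 1) = m + 1 then \<tau>W (\<lambda>i. Y (u i) (k i) (w i)) else 0))"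

text \<open>\<open>\<omega>^(i)\<close>: the conformal vector in the \<open>i\<close>-th tensor factor, the vacuum elsewhere.\<close>

definition conf_at :: "(('i \<Rightarrow> 'v) \<Rightarrow> 't) \<Rightarrow> 'v \<Rightarrow> 'v \<Rightarrow> 'i \<Rightarrow> 't" where
  "conf_at \<tau> vac conf i = \<tau> ((\<lambda>_. vac)(i := conf))"

definition tensor_vac :: "(('i \<Rightarrow> 'v) \<Rightarrow> 't) \<Rightarrow> 'v \<Rightarrow> 't" where
  "tensor_vac \<tau> vac = \<tau> (\<lambda>_. vac)"

definition tensor_conf :: "(('i::finite \<Rightarrow> 'v) \<Rightarrow> 't::ab_group_add) \<Rightarrow> 'v \<Rightarrow> 'v \<Rightarrow> 't" where
  "tensor_conf \<tau> vac conf = (\<Sum>i\<in>UNIV. conf_at \<tau> vac conf i)"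

locale tensor_power_voa =
  V: voa sV YV vac conf c +
  T: voa sT YT "tensor_vac \<tau> vac" "tensor_conf \<tau> vac conf" "of_nat CARD('i) * c"
  for sV :: "complex \<Rightarrow> 'v::ab_group_add \<Rightarrow> 'v" and YV vac conf c
    and sT :: "complex \<Rightarrow> 't::ab_group_add \<Rightarrow> 't" and YT
    and \<tau> :: "('i::finite \<Rightarrow> 'v) \<Rightarrow> 't" +
  assumes tensor_power: "is_tensor_power sV sT \<tau>"
    and tensor_modes: "tensor_modes \<tau> \<tau> YV YT"

locale tensor_power_module =
  tensor_power_voa sV YV vac conf c sT YT \<tau>V +
  W: voa_module sV YV vac conf c sW YW +
  TW: voa_module sT YT "tensor_vac \<tau>V vac" "tensor_conf \<tau>V vac conf" "of_nat CARD('i) * c" sTW YTW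
  for sV :: "complex \<Rightarrow> 'v::ab_group_add \<Rightarrow> 'v" and YV vac conf c
    and sT :: "complex \<Rightarrow> 't::ab_group_add \<Rightarrow> 't" and YT
    and \<tau>V :: "('i::finite \<Rightarrow> 'v) \<Rightarrow> 't"
    and sW :: "complex \<Rightarrow> 'w::ab_group_add \<Rightarrow> 'w" and YW
    and sTW :: "complex \<Rightarrow> 'u::ab_group_add \<Rightarrow> 'u" and YTW
    and \<tau>W :: "('i \<Rightarrow> 'w) \<Rightarrow> 'u" +
  assumes module_tensor_power: "is_tensor_power sW sTW \<tau>W"
    and module_tensor_modes: "tensor_modes \<tau>V \<tau>W YW YTW"

section \<open>Integral forms\<close>

definition vertex_subring ::
  "('v::ab_group_add \<Rightarrow> int \<Rightarrow> 'v \<Rightarrow> 'v) \<Rightarrow> 'v \<Rightarrow> 'v set \<Rightarrow> bool" where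
  "vertex_subring Y vac A \<longleftrightarrow>
     add_subgroup A \<and> vac \<in> A \<and> (\<forall>u\<in>A. \<forall>v\<in>A. \<forall>m. Y u m v \<in> A)"

definition vertex_ring_submodule ::
  "('v \<Rightarrow> int \<Rightarrow> 'w::ab_group_add \<Rightarrow> 'w) \<Rightarrow> 'v set \<Rightarrow> 'w set \<Rightarrow> bool" where
  "vertex_ring_submodule YW A M \<longleftrightarrow> add_subgroup M \<and> (\<forall>u\<in>A. \<forall>m. \<forall>w\<in>M. YW u m w \<in> M)"

definition module_integral_form ::
  "(complex \<Rightarrow> 'w::ab_group_add \<Rightarrow> 'w) \<Rightarrow> ('v \<Rightarrow> int \<Rightarrow> 'w \<Rightarrow> 'w) \<Rightarrow> 'v \<Rightarrow> 'v set \<Rightarrow> 'w set \<Rightarrow> bool" where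
  "module_integral_form sW YW conf A M \<longleftrightarrow>
     vertex_ring_submodule YW A M \<and>
     (\<exists>B. is_basis sW B \<and> M = int_span sW B) \<and>
     internal_direct_sum (\<lambda>h. weight_space sW YW conf h \<inter> M) M"

section \<open>Codes\<close>

definition binary_linear_code :: "'i set set \<Rightarrow> bool" where
  "binary_linear_code C \<longleftrightarrow> {} \<in> C \<and> (\<forall>S\<in>C. \<forall>T\<in>C. sym_diff S T \<in> C)"

text \<open>The index set \<open>\<Omega>\<close> is the eight-element numeral type \<open>8\<close>, in which the literals
  \<open>1, \<dots>, 8\<close> denote its distinct elements (with \<open>8 = 0\<close>).\<close>

definition hamming_code :: "8 set set" where
  "hamming_code =
     (let H = {{}, {1,2,3,4}, {1,2,5,6}, {1,2,7,8}, {1,3,5,7}, {2,4,5,7}, {2,3,6,7}, {2,3,5,8}}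
      in H \<union> uminus ` H)"

text \<open>In the disjoint union \<open>8 + 8\<close> the two summands are \<open>\<Omega>\<close> and \<open>\<Omega>'\<close>, and \<open>S \<union> T'\<close> is \<open>S <+> T\<close>.\<close>

definition code16 :: "(8 + 8) set set" where
  "code16 = binary_linear_code hull (insert ({} <+> UNIV) {T <+> T | T. T \<in> hamming_code})"

definition omega_set :: "(('i::finite \<Rightarrow> 'v) \<Rightarrow> 't::ab_group_add) \<Rightarrow> 'v \<Rightarrow> 'v \<Rightarrow> 'i set \<Rightarrow> 't" where
  "omega_set \<tau> vac conf T =
     (\<Sum>i\<in>-T. conf_at \<tau> vac conf i) - (\<Sum>i\<in>T. conf_at \<tau> vac conf i)"

definition code_vertex_subring ::
  "('t \<Rightarrow> int \<Rightarrow> 't \<Rightarrow> 't) \<Rightarrow> (('i::finite \<Rightarrow> 'v) \<Rightarrow> 't::ab_group_add) \<Rightarrow> 'v \<Rightarrow> 'v \<Rightarrow> 'i set set \<Rightarrow> 't set" where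
  "code_vertex_subring YT \<tau> vac conf C =
     vertex_subring YT (tensor_vac \<tau> vac) hull (omega_set \<tau> vac conf ` C)"

end

theory Submission
  imports Defs
begin

text \<open>
  The modes \<open>L_S(n)\<close> of \<open>\<omega>_S\<close>, for \<open>S\<close> in the code, satisfy
  \<open>[L_S(m), L_T(n)] = (m - n) L_{S+T}(m + n)\<close> up to a central term. As all \<open>16 - 2|S|\<close> are
  divisible by 16, the central terms and the eigenvalues \<open>(16 - 2|S|)/16\<close> of \<open>L_S(0)\<close> on \<open>v_H\<close>
  are integers, so the submodule generated by \<open>v_H\<close> is the integral span of the words in the
  \<open>L_S(n)\<close> with \<open>n < 0\<close>, applied to \<open>v_H\<close>. The functional \<open>\<lambda>\<close> reading off the coefficient of \<open>v_H\<close>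
  is therefore integral on this submodule, and so are its compositions with words in the modes.
  By irreducibility these compositions separate points of \<open>W_H\<close>. A subgroup of a
  finite-dimensional weight space on which a separating family of functionals is integral is a
  lattice, and the weight spaces are spanned because the code separates the 16 indices, whence the
  modes of the individual \<open>\<omega>^(i)\<close> are complex combinations of the \<open>L_S(n)\<close>.
\<close>

section \<open>Lattices in complex vector spaces\<close>

text \<open>A single tensor factor is not integral in this way: for central charge
  \<open>1/2\<close> the central term is \<open>(m^3 - m)/6\<close> times \<open>1/4\<close>, and
  \<open>L(0)\<close> acts on the lowest weight vector by \<open>1/16\<close>. Combining the 16
  factors with signs multiplies both constants by \<open>16 - 2|S|\<close>, which is where the
  weights of the code enter. Integrality of the structure constants alone does not give a lattice.
  The module \<open>L(1/2,1/16)\<close> is a proper quotient of a Verma module, so the words in the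
  \<open>L_S(n)\<close> satisfy complex linear relations and no basis can be read off from them.
  Finite generation of the weight pieces would not suffice either: the integral span of 1 and the
  square root of 2 is a finitely generated subgroup of a complex line, but of rank 2. It is the
  integral functionals that keep the rank down to the dimension, and irreducibility supplies enough
  of them. Complex spanning and separation of points are both proved for single-factor modes,
  whereas integrality holds only for their signed sums; Fourier inversion, which divides by the
  order of the code, is therefore applied only to complex subspaces.\<close>

lemma linear_rules:
  assumes "Vector_Spaces.linear s1 s2 f"
  shows linear_rule_add: "f (x + y) = f x + f y"
    and linear_rule_scale: "f (s1 c x) = s2 c (f x)"
    and linear_rule_zero: "f 0 = 0"
    and linear_rule_neg: "f (- x) = - f x"
    and linear_rule_diff: "f (x - y) = f x - f y"
    and linear_rule_sum: "f (sum g A) = (\<Sum>a\<in>A. f (g a))"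
proof -
  interpret Vector_Spaces.linear s1 s2 f by fact
  show "f (x + y) = f x + f y" "f (s1 c x) = s2 c (f x)" "f 0 = 0" "f (- x) = - f x"
    "f (x - y) = f x - f y" "f (sum g A) = (\<Sum>a\<in>A. f (g a))"
    by (rule add scale zero neg diff sum)+
qed

lemma linear_domain: "Vector_Spaces.linear s1 s2 f \<Longrightarrow> vector_space s1"
  and linear_codomain: "Vector_Spaces.linear s1 s2 f \<Longrightarrow> vector_space s2"
  by (simp_all add: Vector_Spaces.linear_iff)

lemma add_subgroup_sum:
  assumes "add_subgroup A" "\<And>i. i \<in> I \<Longrightarrow> f i \<in> A"
  shows "sum f I \<in> A"
  using assms by (induction I rule: infinite_finite_induct) (auto simp: add_subgroup_def)

lemma add_subgroup_diff: "add_subgroup A \<Longrightarrow> x \<in> A \<Longrightarrow> y \<in> A \<Longrightarrow> x - y \<in> A"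
  by (simp add: add_subgroup_def flip: add_uminus_conv_diff)

lemma add_subgroup_Sum_any:
  assumes "add_subgroup A" "\<And>i. f i \<in> A"
  shows "Sum_any f \<in> A"
  unfolding Sum_any.expand_set using assms by (intro add_subgroup_sum) auto

lemma add_subgroup_Inter: "\<forall>A\<in>\<A>. add_subgroup A \<Longrightarrow> add_subgroup (\<Inter>\<A>)"
  unfolding add_subgroup_def by auto

lemma add_subgroup_hull: "add_subgroup (add_subgroup hull S)"
  by (rule hull_in) (rule add_subgroup_Inter)

lemma add_subgroup_Int: "add_subgroup A \<Longrightarrow> add_subgroup B \<Longrightarrow> add_subgroup (A \<inter> B)"
  unfolding add_subgroup_def by auto

text \<open>Division with remainder by the least positive element. The group stays inside the
  complex numbers because it will be the image of a lattice under a complex functional.\<close>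

lemma subgroup_Ints_principal:
  fixes A :: "complex set"
  assumes "add_subgroup A" "A \<subseteq> \<int>" "A \<noteq> {0}"
  obtains g where "g \<in> A" "g \<noteq> 0" "\<And>x. x \<in> A \<Longrightarrow> \<exists>k::int. x = of_int k * g"
proof -
  let ?P = "\<lambda>n::nat. n > 0 \<and> of_nat n \<in> A"
  have "\<exists>n. ?P n"
  proof -
    obtain x where x: "x \<in> A" "x \<noteq> 0"
      using assms by (auto simp: add_subgroup_def)
    then obtain k :: int where k: "x = of_int k"
      using assms by (auto elim: Ints_cases)
    obtain m :: nat where m: "k = int m \<or> k = - int m"
      by (metis int_cases2)
    have "of_nat m \<in> A"
      using m x k assms(1) by (auto simp: add_subgroup_def)
    then have "?P m"
      using m x k by auto
    then show ?thesis ..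
  qed
  define n where "n = (LEAST n. ?P n)"
  have n: "?P n"
    unfolding n_def using \<open>\<exists>n. ?P n\<close> by (rule LeastI_ex)
  show ?thesis
  proof
    show "of_nat n \<in> A" "(of_nat n :: complex) \<noteq> 0" using n by auto
    fix x assume x: "x \<in> A"
    then obtain k :: int where k: "x = of_int k"
      using assms by (auto elim: Ints_cases)
    have mult: "of_int l * y \<in> A" if "y \<in> A" for l :: int and y
    proof -
      have nat: "of_nat m * y \<in> A" for m
        using assms(1) that by (induction m) (auto simp: algebra_simps add_subgroup_def)
      show ?thesis
      proof (cases "l \<ge> 0")
        case True
        then show ?thesis using nat[of "nat l"] by simp
      next
        case False
        then have "of_int l * y = - (of_nat (nat (- l)) * y)" by simp
        then show ?thesis using nat assms(1) by (simp add: add_subgroup_def)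
      qed
    qed
    have "x - of_int (k div int n) * of_nat n \<in> A"
      using x n mult assms(1) by (intro add_subgroup_diff) auto
    moreover have "x - of_int (k div int n) * of_nat n = of_nat (nat (k mod int n))"
    proof -
      have "of_int (k mod int n) = (of_int (k - (k div int n) * int n) :: complex)"
        by (simp add: minus_div_mult_eq_mod)
      then show ?thesis using n k by simp
    qed
    ultimately have "of_nat (nat (k mod int n)) \<in> A"
      by simp
    moreover have "nat (k mod int n) < n"
      using n by (simp add: nat_less_iff)
    ultimately have "\<not> 0 < nat (k mod int n)"
      using Least_le[of ?P "nat (k mod int n)"] unfolding n_def by linarith
    moreover have "k mod int n \<ge> 0"
      using n by simp
    ultimately have "k mod int n = 0"
      by linarith
    then have "k = k div int n * int n"
      using div_mult_mod_eq[of k "int n"] by simp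
    then have "x = of_int (k div int n * int n)"
      unfolding k by (rule arg_cong)
    then show "\<exists>k::int. x = of_int k * of_nat n"
      by (intro exI[of _ "k div int n"]) simp
  qed
qed

section \<open>Integral spans and integral functionals\<close>

context
  fixes s :: "complex \<Rightarrow> 'a::ab_group_add \<Rightarrow> 'a"
  assumes vs: "vector_space s"
begin

interpretation vector_space s by (rule vs)

lemma subspace_add_subgroup: "subspace A \<Longrightarrow> add_subgroup A"
  by (auto simp: add_subgroup_def subspace_0 subspace_add subspace_neg)

lemma add_subgroup_scale_int:
  assumes "add_subgroup A" "x \<in> A"
  shows "s (of_int k) x \<in> A"
proof -
  have nat: "s (of_nat n) x \<in> A" for n
    using assms by (induction n) (auto simp: scale_left_distrib add_subgroup_def)
  show ?thesis
  proof (cases "k \<ge> 0")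
    case True
    then show ?thesis using nat[of "nat k"] by simp
  next
    case False
    then have "s (of_int k) x = - s (of_nat (nat (- k))) x" by simp
    then show ?thesis using nat assms by (simp add: add_subgroup_def)
  qed
qed

lemma add_subgroup_scale_Ints: "add_subgroup A \<Longrightarrow> x \<in> A \<Longrightarrow> c \<in> \<int> \<Longrightarrow> s c x \<in> A"
  by (elim Ints_cases) (auto intro: add_subgroup_scale_int)

lemma int_span_eq_hull: "int_span s B = add_subgroup hull B"
proof
  have "add_subgroup (int_span s B)"
    unfolding add_subgroup_def
  proof safe
    show "0 \<in> int_span s B"
      unfolding int_span_def by (auto intro: exI[of _ "{}"])
  next
    fix x y assume "x \<in> int_span s B" "y \<in> int_span s B"
    then obtain F k G l where F: "finite F" "F \<subseteq> B" "x = (\<Sum>b\<in>F. s (of_int (k b)) b)"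
      and G: "finite G" "G \<subseteq> B" "y = (\<Sum>b\<in>G. s (of_int (l b)) b)"
      unfolding int_span_def by blast
    let ?m = "\<lambda>b. (if b \<in> F then k b else 0) + (if b \<in> G then l b else 0)"
    have "x = (\<Sum>b\<in>F \<union> G. s (of_int (if b \<in> F then k b else 0)) b)"
      unfolding F(3) using F G by (intro sum.mono_neutral_cong_left) auto
    moreover have "y = (\<Sum>b\<in>F \<union> G. s (of_int (if b \<in> G then l b else 0)) b)"
      unfolding G(3) using F G by (intro sum.mono_neutral_cong_left) auto
    ultimately have "x + y = (\<Sum>b\<in>F \<union> G. s (of_int (?m b)) b)"
      by (simp only: of_int_add scale_left_distrib sum.distrib)
    then show "x + y \<in> int_span s B"
      unfolding int_span_def using F G by (intro CollectI exI[of _ "F \<union> G"] exI[of _ ?m]) auto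
  next
    fix x assume "x \<in> int_span s B"
    then obtain F k where F: "finite F" "F \<subseteq> B" "x = (\<Sum>b\<in>F. s (of_int (k b)) b)"
      unfolding int_span_def by blast
    have "- x = (\<Sum>b\<in>F. s (of_int (- k b)) b)"
      unfolding F(3) by (simp add: sum_negf)
    then show "- x \<in> int_span s B"
      unfolding int_span_def using F by (intro CollectI exI[of _ F] exI[of _ "\<lambda>b. - k b"]) auto
  qed
  moreover have "B \<subseteq> int_span s B"
  proof
    fix b assume "b \<in> B"
    then show "b \<in> int_span s B"
      unfolding int_span_def by (intro CollectI exI[of _ "{b}"] exI[of _ "\<lambda>_. 1"]) auto
  qed
  ultimately show "add_subgroup hull B \<subseteq> int_span s B"
    by (intro hull_minimal) auto
  have "(\<Sum>b\<in>F. s (of_int (k b)) b) \<in> add_subgroup hull B" if "F \<subseteq> B" for F and k :: "'a \<Rightarrow> int"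
    using that
    by (intro add_subgroup_sum add_subgroup_scale_int add_subgroup_hull) (auto intro: hull_inc)
  then show "int_span s B \<subseteq> add_subgroup hull B"
    by (auto simp: int_span_def)
qed

lemma span_add_subgroup_hull: "span (add_subgroup hull B) = span B"
proof
  have "add_subgroup hull B \<subseteq> span B"
    by (rule hull_minimal[where S=add_subgroup, OF span_superset subspace_add_subgroup[OF subspace_span]])
  then show "span (add_subgroup hull B) \<subseteq> span B"
    by (rule span_minimal[OF _ subspace_span])
  show "span B \<subseteq> span (add_subgroup hull B)"
    by (rule span_mono[OF hull_subset])
qed

lemma linear_image_add_subgroup:
  assumes lin: "Vector_Spaces.linear s s' f" and M: "add_subgroup M"
  shows "add_subgroup (f ` M)"
  unfolding add_subgroup_def
proof (intro conjI ballI)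
  show "0 \<in> f ` M"
    using M by (intro image_eqI[of _ _ 0]) (auto simp: add_subgroup_def linear_rule_zero[OF lin])
next
  fix a assume "a \<in> f ` M"
  then obtain x where x: "x \<in> M" "a = f x" by blast
  then show "- a \<in> f ` M"
    using M by (intro image_eqI[of _ _ "- x"]) (auto simp: add_subgroup_def linear_rule_neg[OF lin])
  fix b assume "b \<in> f ` M"
  then obtain y where "y \<in> M" "b = f y" by blast
  then show "a + b \<in> f ` M"
    using M x by (intro image_eqI[of _ _ "x + y"]) (auto simp: add_subgroup_def linear_rule_add[OF lin])
qed

lemma linear_vimage_add_subgroup:
  assumes "Vector_Spaces.linear s s' f" "add_subgroup A"
  shows "add_subgroup {x. f x \<in> A}"
  using assms(2) unfolding add_subgroup_def
  by (auto simp: linear_rules[OF assms(1)])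

text \<open>Induction on the dimension: a functional which is nonzero on \<open>M\<close> has a principal ideal as its
  image, so its restriction to \<open>M\<close> splits.\<close>

lemma integral_functionals_imp_lattice:
  assumes "add_subgroup M" "finite F" "M \<subseteq> span F"
    and "\<And>\<phi>. \<phi> \<in> \<Phi> \<Longrightarrow> Vector_Spaces.linear s (*) \<phi>"
    and "\<And>\<phi> x. \<phi> \<in> \<Phi> \<Longrightarrow> x \<in> M \<Longrightarrow> \<phi> x \<in> \<int>"
    and "\<And>x. x \<in> M \<Longrightarrow> x \<noteq> 0 \<Longrightarrow> \<exists>\<phi>\<in>\<Phi>. \<phi> x \<noteq> 0"
  shows "\<exists>B. independent B \<and> M = int_span s B"
  using assms(1-3,5,6)
proof (induction "card F" arbitrary: F M rule: less_induct)
  case less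
  note M = \<open>add_subgroup M\<close>
  show ?case
  proof (cases "M = {0}")
    case True
    then have "M = int_span s {}"
      by (auto simp: int_span_def)
    then show ?thesis using independent_empty by blast
  next
    case False
    then obtain x where "x \<in> M" "x \<noteq> 0"
      using M by (auto simp: add_subgroup_def)
    with less.prems(5) obtain \<phi> where x: "x \<in> M" "\<phi> \<in> \<Phi>" "\<phi> x \<noteq> 0"
      by blast
    note lin = assms(4)[OF x(2)]
    note rules = linear_rules[OF lin]
    have "add_subgroup (\<phi> ` M)"
      using lin M by (rule linear_image_add_subgroup)
    moreover have "\<phi> ` M \<subseteq> \<int>" using less.prems x by auto
    moreover have "\<phi> ` M \<noteq> {0}" using x by auto
    ultimately obtain g where g: "g \<in> \<phi> ` M" "g \<noteq> 0" "\<And>y. y \<in> \<phi> ` M \<Longrightarrow> \<exists>k::int. y = of_int k * g"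
      by (rule subgroup_Ints_principal) blast
    then obtain b where b: "b \<in> M" "\<phi> b = g" by auto
    define M' where "M' = M \<inter> {y. \<phi> y = 0}"
    have ker: "subspace {y. \<phi> y = 0}"
      by (auto simp: subspace_def rules)
    have M': "add_subgroup M'"
      unfolding M'_def by (rule add_subgroup_Int[OF M subspace_add_subgroup[OF ker]])
    obtain f where f: "f \<in> F" "\<phi> f \<noteq> 0"
    proof (rule ccontr)
      assume "\<not> thesis"
      then have "F \<subseteq> {y. \<phi> y = 0}" using that by auto
      then have "span F \<subseteq> {y. \<phi> y = 0}" using ker by (rule span_minimal)
      then show False using less.prems x by auto
    qed
    \<comment> \<open>\<open>p\<close> projects along \<open>f\<close> onto the kernel of
      \<open>\<phi>\<close> and kills \<open>f\<close>, so the part of \<open>span F\<close> in this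
      kernel is spanned by the images of the remaining vectors. The induction runs on the size of a
      spanning set, which need not lie in \<open>M\<close>.\<close>
    define p where "p y = y - s (\<phi> y / \<phi> f) f" for y
    have p_add: "p (y + z) = p y + p z" for y z
      by (simp add: p_def rules add_divide_distrib scale_left_distrib)
    have p_scale: "p (s c y) = s c (p y)" for c y
      by (simp add: p_def rules scale_right_diff_distrib)
    define F' where "F' = p ` (F - {f})"
    have "finite F'" using less.prems by (simp add: F'_def)
    have "span F \<subseteq> {y. p y \<in> span F'}"
    proof (rule span_minimal)
      have "p f = 0" using f by (simp add: p_def)
      then show "F \<subseteq> {y. p y \<in> span F'}"
        by (metis (mono_tags, lifting) DiffI F'_def image_eqI mem_Collect_eq singletonD span_base span_zero subsetI)
      show "subspace {y. p y \<in> span F'}"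
        unfolding subspace_def
        by (auto simp: p_add p_scale span_add span_scale) (simp add: p_def rules span_zero)
    qed
    then have M'_span: "M' \<subseteq> span F'"
      using less.prems(3) by (auto simp: M'_def p_def)
    have "card F' \<le> card (F - {f})"
      unfolding F'_def using \<open>finite F\<close> by (intro card_image_le) simp
    also have "\<dots> < card F"
      using \<open>finite F\<close> f(1) by (rule card_Diff1_less)
    finally obtain B' where B': "independent B'" "M' = int_span s B'"
      using less.hyps[OF _ M' \<open>finite F'\<close> M'_span] less.prems(4,5) by (auto simp: M'_def)
    have "B' \<subseteq> M'"
      unfolding B'(2) int_span_eq_hull by (rule hull_subset)
    have "b \<notin> span B'"
    proof
      assume "b \<in> span B'"
      moreover have "span B' \<subseteq> {y. \<phi> y = 0}"
        using \<open>B' \<subseteq> M'\<close> ker by (intro span_minimal) (auto simp: M'_def)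
      ultimately show False using b g by auto
    qed
    then have "independent (insert b B')"
      using B' by (simp add: independent_insert)
    moreover have "M = int_span s (insert b B')"
    proof
      show "int_span s (insert b B') \<subseteq> M"
        unfolding int_span_eq_hull using M b \<open>B' \<subseteq> M'\<close> by (intro hull_minimal) (auto simp: M'_def)
      show "M \<subseteq> int_span s (insert b B')"
      proof
        fix y assume y: "y \<in> M"
        then obtain k :: int where k: "\<phi> y = of_int k * g" using g by blast
        have "y - s (of_int k) b \<in> M'"
          using y b M k add_subgroup_scale_int by (auto simp: M'_def rules intro!: add_subgroup_diff)
        also have "M' \<subseteq> add_subgroup hull (insert b B')"
          unfolding B'(2) int_span_eq_hull by (intro hull_mono) auto
        finally have "(y - s (of_int k) b) + s (of_int k) b \<in> add_subgroup hull (insert b B')"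
          using add_subgroup_hull[of "insert b B'"]
          by (metis add_subgroup_def add_subgroup_scale_int hull_inc insertI1)
        then show "y \<in> int_span s (insert b B')"
          by (simp add: int_span_eq_hull)
      qed
    qed
    ultimately show ?thesis by blast
  qed
qed

end

text \<open>The projections are the components of the inverse of the summation bijection. Each
  property follows from injectivity: exhibit an admissible family with the right sum.\<close>

lemma direct_sum_projections:
  fixes s :: "complex \<Rightarrow> 'a::ab_group_add \<Rightarrow> 'a" and F :: "'i \<Rightarrow> 'a set"
  assumes vs: "vector_space s" and sub: "\<And>i. module.subspace s (F i)"
    and ds: "internal_direct_sum F UNIV"
  obtains \<pi> where "\<And>i. Vector_Spaces.linear s s (\<pi> i)" "\<And>i x. \<pi> i x \<in> F i"
    "\<And>x. finite {i. \<pi> i x \<noteq> 0}" "\<And>x. Sum_any (\<lambda>i. \<pi> i x) = x"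
    "\<And>i x. x \<in> F i \<Longrightarrow> \<pi> i x = x" "\<And>i j x. x \<in> F i \<Longrightarrow> i \<noteq> j \<Longrightarrow> \<pi> j x = 0"
proof -
  interpret vector_space s by (rule vs)
  define D where "D = {f. finite {i. f i \<noteq> 0} \<and> (\<forall>i. f i \<in> F i)}"
  have bij: "bij_betw Sum_any D UNIV"
    using ds unfolding internal_direct_sum_def D_def .
  define \<pi> where "\<pi> i x = inv_into D Sum_any x i" for i x
  have mem: "(\<lambda>i. \<pi> i x) \<in> D" and sum: "Sum_any (\<lambda>i. \<pi> i x) = x" for x
    using bij_betw_imp_surj_on[OF bij] inv_into_into[of x Sum_any D] f_inv_into_f[of x Sum_any D]
    by (simp_all add: \<pi>_def)
  have uniq: "\<pi> i x = f i" if "f \<in> D" "Sum_any f = x" for f x i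
    using bij_betw_imp_inj_on[OF bij] that by (auto simp: \<pi>_def)
  have fin: "finite {i. \<pi> i x \<noteq> 0}" and F: "\<pi> i x \<in> F i" for i x
    using mem[of x] by (simp_all add: D_def)
  have single: "\<pi> j x = (if j = i then x else 0)" if "x \<in> F i" for i j x
  proof (rule uniq)
    show "(\<lambda>j. if j = i then x else 0) \<in> D"
      using that by (auto simp: D_def subspace_0[OF sub] intro: finite_subset[of _ "{i}"])
    show "Sum_any (\<lambda>j. if j = i then x else 0) = x"
      by (simp add: Sum_any.expand_superset[of "{i}"])
  qed
  show ?thesis
  proof
    fix i
    have "\<pi> i (x + y) = \<pi> i x + \<pi> i y" for x y
    proof (rule uniq)
      have "finite {i. \<pi> i x + \<pi> i y \<noteq> 0}"
        by (rule finite_subset[OF _ finite_UnI[OF fin[of x] fin[of y]]]) auto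
      then show "(\<lambda>i. \<pi> i x + \<pi> i y) \<in> D"
        by (simp add: D_def F subspace_add[OF sub])
      show "Sum_any (\<lambda>i. \<pi> i x + \<pi> i y) = x + y"
        by (simp add: Sum_any.distrib fin sum)
    qed
    moreover have "\<pi> i (s c x) = s c (\<pi> i x)" for c x
    proof (rule uniq)
      have sup: "{i. s c (\<pi> i x) \<noteq> 0} \<subseteq> {i. \<pi> i x \<noteq> 0}"
        by auto
      then show "(\<lambda>i. s c (\<pi> i x)) \<in> D"
        using finite_subset[OF _ fin[of x]] by (simp add: D_def F subspace_scale[OF sub])
      have "Sum_any (\<lambda>i. s c (\<pi> i x)) = s c (Sum_any (\<lambda>i. \<pi> i x))"
        by (simp add: Sum_any.expand_superset[OF fin sup] Sum_any.expand_set[of "\<lambda>i. \<pi> i x"] scale_sum_right)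
      then show "Sum_any (\<lambda>i. s c (\<pi> i x)) = s c x"
        by (simp add: sum)
    qed
    ultimately show "Vector_Spaces.linear s s (\<pi> i)"
      by (simp add: Vector_Spaces.linear_iff vs)
  qed (use fin F sum single in auto)
qed

text \<open>Each projection sends a homogeneous generator to itself or to 0, so the generated group
  contains the components of all its elements. Bases of the homogeneous pieces can then be
  united.\<close>

lemma graded_lattice:
  fixes s :: "complex \<Rightarrow> 'a::ab_group_add \<Rightarrow> 'a" and F :: "'i \<Rightarrow> 'a set"
  assumes vs: "vector_space s" and sub: "\<And>i. module.subspace s (F i)"
    and ds: "internal_direct_sum F UNIV"
    and M: "M = add_subgroup hull N" and N: "\<And>x. x \<in> N \<Longrightarrow> \<exists>i. x \<in> F i"
    and B: "\<And>i. \<exists>B. \<not> module.dependent s B \<and> F i \<inter> M = int_span s B"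
  shows "\<exists>B. \<not> module.dependent s B \<and> M = int_span s B"
    and "internal_direct_sum (\<lambda>i. F i \<inter> M) M"
proof -
  interpret vector_space s by (rule vs)
  obtain \<pi> where lin: "\<And>i. Vector_Spaces.linear s s (\<pi> i)" and \<pi>F: "\<And>i x. \<pi> i x \<in> F i"
    and fin: "\<And>x. finite {i. \<pi> i x \<noteq> 0}" and sum: "\<And>x. Sum_any (\<lambda>i. \<pi> i x) = x"
    and id: "\<And>i x. x \<in> F i \<Longrightarrow> \<pi> i x = x" and zero: "\<And>i j x. x \<in> F i \<Longrightarrow> i \<noteq> j \<Longrightarrow> \<pi> j x = 0"
    by (rule direct_sum_projections[OF vs sub ds]) blast
  have sM: "add_subgroup M"
    unfolding M by (rule add_subgroup_hull)
  have \<pi>M: "\<pi> i x \<in> M" if "x \<in> M" for i x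
    using that unfolding M
  proof (rule hull_induct)
    fix x assume x: "x \<in> N"
    then obtain j where "x \<in> F j" using N by blast
    then show "\<pi> i x \<in> add_subgroup hull N"
      using id[of x j] zero[of x j i] add_subgroup_hull[of N] x
      by (cases "i = j") (auto simp: hull_inc add_subgroup_def)
  next
    show "add_subgroup {x. \<pi> i x \<in> add_subgroup hull N}"
      by (rule linear_vimage_add_subgroup[OF vs lin add_subgroup_hull])
  qed
  show "internal_direct_sum (\<lambda>i. F i \<inter> M) M"
    unfolding internal_direct_sum_def
  proof (rule bij_betw_imageI)
    have "inj_on Sum_any {f. finite {i. f i \<noteq> 0} \<and> (\<forall>i. f i \<in> F i)}"
      using ds unfolding internal_direct_sum_def by (rule bij_betw_imp_inj_on)
    then show "inj_on Sum_any {f. finite {i. f i \<noteq> 0} \<and> (\<forall>i. f i \<in> F i \<inter> M)}"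
      by (rule inj_on_subset) auto
    show "Sum_any ` {f. finite {i. f i \<noteq> 0} \<and> (\<forall>i. f i \<in> F i \<inter> M)} = M"
    proof safe
      fix f assume "\<forall>i. f i \<in> F i \<inter> M"
      then show "Sum_any f \<in> M"
        by (intro add_subgroup_Sum_any[OF sM]) simp
    next
      fix x assume "x \<in> M"
      then show "x \<in> Sum_any ` {f. finite {i. f i \<noteq> 0} \<and> (\<forall>i. f i \<in> F i \<inter> M)}"
        by (intro image_eqI[of _ _ "\<lambda>i. \<pi> i x"]) (simp_all add: sum fin \<pi>F \<pi>M)
    qed
  qed
  obtain Bs where Bs: "\<And>i. independent (Bs i)" "\<And>i. F i \<inter> M = int_span s (Bs i)"
    using B by metis
  have BsF: "Bs i \<subseteq> F i \<inter> M" for i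
    unfolding Bs(2) int_span_eq_hull[OF vs] by (rule hull_subset)
  have "independent (\<Union>i. Bs i)"
    unfolding independent_explicit_module
  proof (intro allI impI)
    fix t u v assume t: "finite t" "t \<subseteq> (\<Union>i. Bs i)" "(\<Sum>v\<in>t. s (u v) v) = 0" "v \<in> t"
    then obtain i where i: "v \<in> Bs i" by blast
    have "\<pi> i w = (if w \<in> Bs i then w else 0)" if w: "w \<in> t" for w
    proof -
      obtain j where "w \<in> Bs j" using t(2) w by blast
      then show ?thesis
        using BsF[of j] BsF[of i] id[of w] zero[of w j i] by (cases "i = j") auto
    qed
    then have "(\<Sum>w\<in>t. s (u w) (if w \<in> Bs i then w else 0)) = \<pi> i (\<Sum>v\<in>t. s (u v) v)"
      by (simp add: linear_rule_sum[OF lin] linear_rule_scale[OF lin])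
    also have "\<dots> = 0"
      using t linear_rule_zero[OF lin] by simp
    also have "(\<Sum>w\<in>t. s (u w) (if w \<in> Bs i then w else 0)) = (\<Sum>w\<in>t \<inter> Bs i. s (u w) w)"
      using t(1) by (intro sum.mono_neutral_cong_right) auto
    finally show "u v = 0"
      using independentD[OF Bs(1), of "t \<inter> Bs i" i u v] t i by auto
  qed
  moreover have "M = int_span s (\<Union>i. Bs i)"
    unfolding int_span_eq_hull[OF vs]
  proof
    show "add_subgroup hull (\<Union>i. Bs i) \<subseteq> M"
      using BsF sM by (intro hull_minimal) auto
    show "M \<subseteq> add_subgroup hull (\<Union>i. Bs i)"
    proof
      fix x assume x: "x \<in> M"
      have "\<pi> i x \<in> add_subgroup hull (\<Union>i. Bs i)" for i
      proof -
        have "\<pi> i x \<in> add_subgroup hull Bs i"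
          using \<pi>F[of i x] \<pi>M[OF x, of i] Bs(2)[of i] int_span_eq_hull[OF vs] by auto
        moreover have "add_subgroup hull Bs i \<subseteq> add_subgroup hull (\<Union>i. Bs i)"
          by (rule hull_mono) auto
        ultimately show ?thesis by blast
      qed
      then have "Sum_any (\<lambda>i. \<pi> i x) \<in> add_subgroup hull (\<Union>i. Bs i)"
        by (rule add_subgroup_Sum_any[OF add_subgroup_hull])
      then show "x \<in> add_subgroup hull (\<Union>i. Bs i)"
        by (simp add: sum)
    qed
  qed
  ultimately show "\<exists>B. independent B \<and> M = int_span s B"
    by blast
qed

section \<open>Words in lowering operators\<close>

text \<open>One notion for two coefficient sets: integers give additive subgroups, all complex
  numbers give subspaces. The straightening argument for words is thus done once, for the lattice
  and for the complex span in a single factor.\<close>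

definition coeff_submodule ::
  "(complex \<Rightarrow> 'a::ab_group_add \<Rightarrow> 'a) \<Rightarrow> complex set \<Rightarrow> 'a set \<Rightarrow> bool" where
  "coeff_submodule s R A \<longleftrightarrow>
     0 \<in> A \<and> (\<forall>x\<in>A. \<forall>y\<in>A. x + y \<in> A) \<and> (\<forall>c\<in>R. \<forall>x\<in>A. s c x \<in> A)"

lemma coeff_submodule_Ints:
  assumes "vector_space s"
  shows "coeff_submodule s \<int> = add_subgroup"
proof (intro ext iffI)
  interpret vector_space s by fact
  fix A
  show "add_subgroup A" if "coeff_submodule s \<int> A"
    using that unfolding coeff_submodule_def add_subgroup_def
    by (metis Ints_1 Ints_minus scale_minus_left scale_one)
  show "coeff_submodule s \<int> A" if "add_subgroup A"
    using that add_subgroup_scale_Ints[OF assms that]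
    by (simp add: coeff_submodule_def add_subgroup_def)
qed

lemma coeff_submodule_UNIV:
  assumes "vector_space s"
  shows "coeff_submodule s UNIV = module.subspace s"
proof -
  interpret vector_space s by fact
  show ?thesis
    by (intro ext) (auto simp: coeff_submodule_def subspace_def)
qed

lemma coeff_submodule_hull: "coeff_submodule s R (coeff_submodule s R hull S)"
  by (rule hull_in) (auto simp: coeff_submodule_def)

lemma coeff_submodule_vimage:
  assumes "Vector_Spaces.linear s s' f" "coeff_submodule s' R A"
  shows "coeff_submodule s R {x. f x \<in> A}"
  using assms(2) by (auto simp: coeff_submodule_def linear_rules[OF assms(1)])

text \<open>Words are not ordered as in a PBW basis: they serve as generators, and relations among
  them are harmless.\<close>

inductive_set lowering_words :: "('b \<Rightarrow> int \<Rightarrow> 'a \<Rightarrow> 'a) \<Rightarrow> 'b set \<Rightarrow> 'a \<Rightarrow> 'a set"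
  for L :: "'b \<Rightarrow> int \<Rightarrow> 'a \<Rightarrow> 'a" and C :: "'b set" and v :: 'a where
  base: "v \<in> lowering_words L C v"
| step: "w \<in> lowering_words L C v \<Longrightarrow> t \<in> C \<Longrightarrow> n < 0 \<Longrightarrow> L t n w \<in> lowering_words L C v"

text \<open>The surjectivity part of the Poincare-Birkhoff-Witt theorem, over any coefficient ring
  containing the structure constants and the eigenvalues on the lowest weight vector.\<close>

lemma lowering_words_hull_closed:
  fixes s :: "complex \<Rightarrow> 'a::ab_group_add \<Rightarrow> 'a" and L :: "'b \<Rightarrow> int \<Rightarrow> 'a \<Rightarrow> 'a"
  assumes R: "\<int> \<subseteq> R"
    and lin: "\<And>t n. t \<in> C \<Longrightarrow> Vector_Spaces.linear s s (L t n)"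
    and comm: "\<And>t u m n w. t \<in> C \<Longrightarrow> u \<in> C \<Longrightarrow> \<exists>r\<in>C. \<exists>z\<in>R.
      L t m (L u n w) = L u n (L t m w) + s (of_int (m - n)) (L r (m + n) w) + s z w"
    and pos: "\<And>t n. t \<in> C \<Longrightarrow> n > 0 \<Longrightarrow> L t n v = 0"
    and zero: "\<And>t. t \<in> C \<Longrightarrow> \<exists>z\<in>R. L t 0 v = s z v"
    and t: "t \<in> C" and w: "w \<in> coeff_submodule s R hull lowering_words L C v"
  shows "L t n w \<in> coeff_submodule s R hull lowering_words L C v"
proof -
  define M where "M = coeff_submodule s R hull lowering_words L C v"
  have M: "coeff_submodule s R M"
    unfolding M_def by (rule coeff_submodule_hull)
  have words: "lowering_words L C v \<subseteq> M"
    unfolding M_def by (rule hull_subset)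
  have extend: "L t n w \<in> M"
    if w: "w \<in> M" and t: "t \<in> C" and *: "\<And>x. x \<in> lowering_words L C v \<Longrightarrow> L t n x \<in> M" for t n w
    using w unfolding M_def
  proof (rule hull_induct)
    show "L t n x \<in> coeff_submodule s R hull lowering_words L C v"
      if "x \<in> lowering_words L C v" for x
      using *[OF that] unfolding M_def .
    show "coeff_submodule s R {x. L t n x \<in> coeff_submodule s R hull lowering_words L C v}"
      by (rule coeff_submodule_vimage[OF lin[OF t] coeff_submodule_hull])
  qed
  have neg: "L t n w \<in> M" if "w \<in> M" "t \<in> C" "n < 0" for t n w
    using that(1,2)
  proof (rule extend)
    show "L t n x \<in> M" if "x \<in> lowering_words L C v" for x
      using lowering_words.step[OF that \<open>t \<in> C\<close> \<open>n < 0\<close>] words by blast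
  qed
  \<comment> \<open>Induction on the word for all modes at once: moving \<open>L t n\<close> past
    the first letter leaves \<open>L r (n + k)\<close> on the shorter word, and the sign of
    \<open>n + k\<close> is not controlled.\<close>
  have "L t n w \<in> M" if "w \<in> lowering_words L C v" "t \<in> C" for t n w
    using that
  proof (induction arbitrary: t n rule: lowering_words.induct)
    case base
    have v: "v \<in> M" by (rule subsetD[OF words lowering_words.base])
    consider "n < 0" | "n = 0" | "n > 0" by linarith
    then show ?case
    proof cases
      case 1
      then show ?thesis using v base by (simp add: neg)
    next
      case 2
      then show ?thesis using zero[OF base] v M by (auto simp: coeff_submodule_def)
    next
      case 3
      then show ?thesis using pos[OF base] M by (auto simp: coeff_submodule_def)
    qed
  next
    case (step w u k)
    obtain r z where r: "r \<in> C" "z \<in> R" "L t n (L u k w) =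
        L u k (L t n w) + s (of_int (n - k)) (L r (n + k) w) + s z w"
      using comm[OF step.prems step.hyps(2)] by blast
    have "L u k (L t n w) \<in> M"
      using neg[OF step.IH[OF step.prems] step.hyps(2,3)] .
    moreover have "s (of_int (n - k)) (L r (n + k) w) \<in> M"
      using M R step.IH[OF r(1)] Ints_of_int unfolding coeff_submodule_def by blast
    moreover have "s z w \<in> M"
      using M r(2) words step.hyps(1) unfolding coeff_submodule_def by blast
    ultimately show ?case
      unfolding r(3) using M unfolding coeff_submodule_def by blast
  qed
  then show ?thesis
    using extend t w unfolding M_def by blast
qed

lemma lowering_words_weight:
  fixes s :: "complex \<Rightarrow> 'a::ab_group_add \<Rightarrow> 'a" and L :: "'b \<Rightarrow> int \<Rightarrow> 'a \<Rightarrow> 'a"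
  assumes lin: "\<And>t n. t \<in> C \<Longrightarrow> Vector_Spaces.linear s s (L t n)"
    and comm: "\<And>t n w. t \<in> C \<Longrightarrow> D (L t n w) = L t n (D w) - s (of_int n) (L t n w)"
    and v: "D v = s h v" and w: "w \<in> lowering_words L C v"
  shows "\<exists>k::nat. D w = s (h + of_nat k) w"
  using w
proof (induction rule: lowering_words.induct)
  case base
  then show ?case using v by (intro exI[of _ 0]) simp
next
  case (step w t n)
  interpret vector_space s by (rule linear_domain[OF lin[OF step.hyps(2)]])
  obtain k :: nat where k: "D w = s (h + of_nat k) w" using step.IH by blast
  have "D (L t n w) = s (h + of_nat k - of_int n) (L t n w)"
    by (simp add: comm[OF step.hyps(2)] k linear_rule_scale[OF lin[OF step.hyps(2)]] scale_left_diff_distrib)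
  also have "h + of_nat k - of_int n = h + of_nat (k + nat (- n))"
    using step.hyps by simp
  finally show ?case
    by (intro exI[of _ "k + nat (- n)"])
qed

section \<open>Tensor powers of vector spaces\<close>

lemma vector_space_complex: "vector_space ((*) :: complex \<Rightarrow> complex \<Rightarrow> complex)"
  by unfold_locales (auto simp: algebra_simps)

lemma is_basis_exists:
  assumes "vector_space s"
  obtains B where "is_basis s B"
proof -
  interpret vector_space s by fact
  show ?thesis
    using that[of "extend_basis {}"] independent_extend_basis[OF independent_empty] span_extend_basis[OF independent_empty]
    by (simp add: is_basis_def)
qed

lemma linear_eq_on_spanning:
  assumes f: "Vector_Spaces.linear s1 s2 f" and g: "Vector_Spaces.linear s1 s2 g"
    and span: "module.span s1 B = UNIV" and eq: "\<And>b. b \<in> B \<Longrightarrow> f b = g b"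
  shows "f x = g x"
proof -
  interpret vector_space_pair s1 s2
    using linear_domain[OF f] linear_codomain[OF f] by (simp add: vector_space_pair_def)
  show ?thesis
    by (rule linear_eq_on[OF f g _ eq]) (simp_all add: span)
qed

lemma multilinear_eq_on_basis:
  fixes m m' :: "('i::finite \<Rightarrow> 'a::ab_group_add) \<Rightarrow> 'b::ab_group_add"
  assumes lin: "\<And>f i. Vector_Spaces.linear s1 s2 (\<lambda>x. m (f(i := x)))"
    and lin': "\<And>f i. Vector_Spaces.linear s1 s2 (\<lambda>x. m' (f(i := x)))"
    and span: "module.span s1 B = UNIV" and eq: "\<And>f. (\<And>i. f i \<in> B) \<Longrightarrow> m f = m' f"
  shows "m f = m' f"
proof -
  have "m f = m' f" if "finite J" "\<And>j. j \<notin> J \<Longrightarrow> f j \<in> B" for J f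
    using that
  proof (induction J arbitrary: f rule: finite_induct)
    case empty
    then show ?case using eq by simp
  next
    case (insert i J)
    have "m (f(i := x)) = m' (f(i := x))" for x
    proof (rule linear_eq_on_spanning[OF lin lin' span])
      fix b assume "b \<in> B"
      then show "m (f(i := b)) = m' (f(i := b))"
        using insert.prems by (intro insert.IH) auto
    qed
    from this[of "f i"] show ?case by simp
  qed
  from this[of UNIV] show ?thesis by simp
qed

lemma tensor_power_linear:
  "is_tensor_power s sT \<tau> \<Longrightarrow> Vector_Spaces.linear s sT (\<lambda>x. \<tau> (f(i := x)))"
  by (simp add: is_tensor_power_def)

lemma tensor_power_zero:
  assumes "is_tensor_power s sT \<tau>" "f i = 0"
  shows "\<tau> f = 0"
  using linear_rule_zero[OF tensor_power_linear[OF assms(1), of f i]] assms(2)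
  by (metis fun_upd_triv)

lemma tensor_power_vector_spaces:
  assumes "is_tensor_power s sT \<tau>"
  shows "vector_space s" "vector_space sT"
  using linear_domain[OF tensor_power_linear[OF assms]] linear_codomain[OF tensor_power_linear[OF assms]] .

lemma tensor_power_span:
  assumes T: "is_tensor_power s sT \<tau>"
  shows "module.span sT (range \<tau>) = UNIV"
proof -
  interpret T: vector_space sT by (rule tensor_power_vector_spaces(2)[OF T])
  obtain B where "is_basis s B"
    by (rule is_basis_exists[OF tensor_power_vector_spaces(1)[OF T]])
  then have "T.span (\<tau> ` (UNIV \<rightarrow> B)) = UNIV"
    using T by (auto simp: is_tensor_power_def is_basis_def)
  moreover have "T.span (\<tau> ` (UNIV \<rightarrow> B)) \<subseteq> T.span (range \<tau>)"
    by (rule T.span_mono) auto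
  ultimately show ?thesis by auto
qed

lemma tensor_power_eqI:
  assumes T: "is_tensor_power s sT \<tau>"
    and g: "Vector_Spaces.linear sT sX g" and g': "Vector_Spaces.linear sT sX g'"
    and eq: "\<And>f. g (\<tau> f) = g' (\<tau> f)"
  shows "g x = g' x"
  by (rule linear_eq_on_spanning[OF g g' tensor_power_span[OF T]]) (auto simp: eq)

text \<open>The universal property, recovered from the definition by bases: prescribe the map on
  pure tensors of basis vectors, which is unambiguous because \<open>\<tau>\<close> is injective
  there.\<close>

lemma tensor_power_lift:
  fixes m :: "('i::finite \<Rightarrow> 'a::ab_group_add) \<Rightarrow> 'b::ab_group_add"
    and \<tau> :: "('i \<Rightarrow> 'a) \<Rightarrow> 't::ab_group_add"
  assumes T: "is_tensor_power s sT \<tau>"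
    and m: "\<And>f i. Vector_Spaces.linear s sX (\<lambda>x. m (f(i := x)))"
  obtains g where "Vector_Spaces.linear sT sX g" "\<And>f. g (\<tau> f) = m f"
proof -
  interpret vector_space_pair sT sX
    using tensor_power_vector_spaces(2)[OF T] linear_codomain[OF m] by (simp add: vector_space_pair_def)
  obtain B where B: "is_basis s B"
    by (rule is_basis_exists[OF tensor_power_vector_spaces(1)[OF T]])
  then have inj: "inj_on \<tau> (UNIV \<rightarrow> B)" and ind: "vs1.independent (\<tau> ` (UNIV \<rightarrow> B))"
    using T by (auto simp: is_tensor_power_def is_basis_def)
  obtain g where g: "Vector_Spaces.linear sT sX g"
    "\<And>e. e \<in> \<tau> ` (UNIV \<rightarrow> B) \<Longrightarrow> g e = m (inv_into (UNIV \<rightarrow> B) \<tau> e)"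
    using linear_independent_extend[OF ind, of "\<lambda>e. m (inv_into (UNIV \<rightarrow> B) \<tau> e)"] by blast
  have "g (\<tau> f) = m f" for f
  proof (rule multilinear_eq_on_basis[of s sX "\<lambda>f. g (\<tau> f)" m B])
    show "Vector_Spaces.linear s sX (\<lambda>x. g (\<tau> (f(i := x))))" for f i
      using Vector_Spaces.linear_compose[OF tensor_power_linear[OF T] g(1)] by (simp add: o_def)
    show "module.span s B = UNIV" using B by (simp add: is_basis_def)
    show "g (\<tau> f) = m f" if "\<And>i. f i \<in> B" for f
      using g(2)[of "\<tau> f"] inv_into_f_f[OF inj, of f] that by auto
  qed (rule m)
  then show ?thesis using that g(1) by blast
qed

lemma product_functional:
  fixes F :: "'i::finite \<Rightarrow> 'a::ab_group_add \<Rightarrow> complex"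
    and \<tau> :: "('i \<Rightarrow> 'a) \<Rightarrow> 't::ab_group_add"
  assumes T: "is_tensor_power s sT \<tau>" and F: "\<And>i. Vector_Spaces.linear s (*) (F i)"
  obtains g where "Vector_Spaces.linear sT (*) g" "\<And>f. g (\<tau> f) = (\<Prod>i\<in>UNIV. F i (f i))"
proof (rule tensor_power_lift[OF T])
  show "Vector_Spaces.linear s (*) (\<lambda>x. \<Prod>j\<in>UNIV. F j ((f(i := x)) j))" for f i
  proof -
    have "(\<Prod>j\<in>UNIV. F j ((f(i := x)) j)) = F i x * (\<Prod>j\<in>-{i}. F j (f j))" for x
    proof -
      have "(\<Prod>j\<in>UNIV. F j ((f(i := x)) j)) = F i x * (\<Prod>j\<in>UNIV - {i}. F j ((f(i := x)) j))"
        by (subst prod.remove[of _ i]) auto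
      also have "(\<Prod>j\<in>UNIV - {i}. F j ((f(i := x)) j)) = (\<Prod>j\<in>-{i}. F j (f j))"
        by (rule prod.cong) auto
      finally show ?thesis .
    qed
    then show ?thesis
      using F[of i] by (simp add: Vector_Spaces.linear_iff algebra_simps)
  qed
qed (use that in blast)

text \<open>Evaluating every slot but \<open>i\<close> leaves a vector of the factor. This map
  commutes with operators acting in slot \<open>i\<close>, so it carries submodules of the tensor
  power to submodules of the factor.\<close>

lemma tensor_contraction:
  fixes F :: "'i::finite \<Rightarrow> 'a::ab_group_add \<Rightarrow> complex"
    and \<tau> :: "('i \<Rightarrow> 'a) \<Rightarrow> 't::ab_group_add"
  assumes T: "is_tensor_power s sT \<tau>" and F: "\<And>i. Vector_Spaces.linear s (*) (F i)"
  obtains g where "Vector_Spaces.linear sT s g" "\<And>f. g (\<tau> f) = s (\<Prod>j\<in>-{i}. F j (f j)) (f i)"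
proof (rule tensor_power_lift[OF T])
  interpret vector_space s by (rule tensor_power_vector_spaces(1)[OF T])
  show "Vector_Spaces.linear s s (\<lambda>x. s (\<Prod>j\<in>-{i}. F j ((f(k := x)) j)) ((f(k := x)) i))" for f k
  proof (cases "k = i")
    case True
    then have "(\<Prod>j\<in>-{i}. F j ((f(k := x)) j)) = (\<Prod>j\<in>-{i}. F j (f j))" for x
      by (intro prod.cong) auto
    with True show ?thesis
      by (simp add: Vector_Spaces.linear_iff vector_space_axioms scale_right_distrib mult.commute)
  next
    case False
    have "(\<Prod>j\<in>-{i}. F j ((f(k := x)) j)) = F k x * (\<Prod>j\<in>-{i}-{k}. F j (f j))" for x
    proof -
      have "(\<Prod>j\<in>-{i}. F j ((f(k := x)) j)) = F k x * (\<Prod>j\<in>-{i}-{k}. F j ((f(k := x)) j))"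
        using False by (subst prod.remove[of _ k]) auto
      also have "(\<Prod>j\<in>-{i}-{k}. F j ((f(k := x)) j)) = (\<Prod>j\<in>-{i}-{k}. F j (f j))"
        by (rule prod.cong) auto
      finally show ?thesis .
    qed
    with False F[of k] show ?thesis
      by (simp add: Vector_Spaces.linear_iff vector_space_axioms scale_left_distrib distrib_right mult.assoc)
  qed
qed (use that in blast)

text \<open>Products of coordinate functions of a basis of the factor are the coordinate functions
  of the basis of pure tensors.\<close>

lemma tensor_coordinates_zero:
  fixes \<tau> :: "('i::finite \<Rightarrow> 'a::ab_group_add) \<Rightarrow> 't::ab_group_add"
  assumes T: "is_tensor_power s sT \<tau>"
    and zero: "\<And>F g. (\<And>i. Vector_Spaces.linear s (*) (F i)) \<Longrightarrow> Vector_Spaces.linear sT (*) g \<Longrightarrow>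
      (\<And>f. g (\<tau> f) = (\<Prod>i\<in>UNIV. F i (f i))) \<Longrightarrow> g x = 0"
  shows "x = 0"
proof -
  interpret A: vector_space s by (rule tensor_power_vector_spaces(1)[OF T])
  interpret T: vector_space sT by (rule tensor_power_vector_spaces(2)[OF T])
  obtain B where B: "is_basis s B"
    by (rule is_basis_exists[OF tensor_power_vector_spaces(1)[OF T]])
  define E where "E = \<tau> ` (UNIV \<rightarrow> B)"
  have inj: "inj_on \<tau> (UNIV \<rightarrow> B)" and E: "T.independent E" "T.span E = UNIV"
    and B: "A.independent B" "A.span B = UNIV"
    using T B by (auto simp: is_tensor_power_def is_basis_def E_def)
  have "T.representation E x e = 0" for e
  proof (cases "e \<in> E")
    case False
    then show ?thesis using T.representation_ne_zero by blast
  next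
    case True
    then obtain f where f: "f \<in> UNIV \<rightarrow> B" "e = \<tau> f"
      unfolding E_def by blast
    define F where "F i w = A.representation B w (f i)" for i w
    have F: "Vector_Spaces.linear s (*) (F i)" for i
      unfolding F_def by (rule A.linear_representation[OF B])
    obtain g where g: "Vector_Spaces.linear sT (*) g" "\<And>f. g (\<tau> f) = (\<Prod>i\<in>UNIV. F i (f i))"
      by (rule product_functional[where F=F, OF T F], rule that)
    have "T.representation E y e = g y" for y
    proof (rule linear_eq_on_spanning[OF T.linear_representation[OF E] g(1) E(2)])
      fix b assume "b \<in> E"
      then obtain f' where f': "f' \<in> UNIV \<rightarrow> B" "b = \<tau> f'"
        unfolding E_def by blast
      have "T.representation E b e = (if e = b then 1 else 0)"
        using T.representation_basis[OF E(1) \<open>b \<in> E\<close>] by simp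
      also have "e = b \<longleftrightarrow> f = f'"
        using inj_on_eq_iff[OF inj f(1) f'(1)] f(2) f'(2) by simp
      also have "(if f = f' then 1 else 0) = g b"
      proof -
        have "F i (f' i) = (if f i = f' i then 1 else 0)" for i
        proof -
          have "f' i \<in> B" using f'(1) by auto
          then show ?thesis using A.representation_basis[OF B(1)] by (simp add: F_def)
        qed
        then show ?thesis
          by (auto simp: f'(2) g(2) fun_eq_iff intro!: prod_zero[symmetric])
      qed
      finally show "T.representation E b e = g b" .
    qed
    then show ?thesis
      using zero[OF F g(1) g(2)] by simp
  qed
  then show "x = 0"
    using T.sum_nonzero_representation_eq[OF E(1), of x] E(2) by simp
qed

section \<open>Tensor powers of lowest weight modules\<close>

text \<open>The lowest weight vector is fixed rather than existentially quantified because the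
  lattice is generated by it. The grading by \<open>L 0\<close> provides the projection onto the
  lowest weight space.\<close>

locale lowest_weight_module =
  fixes s :: "complex \<Rightarrow> 'a::ab_group_add \<Rightarrow> 'a" and L :: "int \<Rightarrow> 'a \<Rightarrow> 'a" and c h :: complex and v :: 'a
  assumes relations: "virasoro_relations s c L"
    and v_nonzero: "v \<noteq> 0"
    and v_pos: "n > 0 \<Longrightarrow> L n v = 0"
    and v_zero: "L 0 v = s h v"
    and cyclic: "virasoro_submodule s L hull {v} = UNIV"
    and irreducible: "virasoro_submodule s L U \<Longrightarrow> U = {0} \<or> U = UNIV"
    and grading: "internal_direct_sum (\<lambda>k. {w. L 0 w = s k w}) UNIV"
begin

lemma L_linear: "Vector_Spaces.linear s s (L n)"
  using relations by (simp add: virasoro_relations_def)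

sublocale vector_space s
  by (rule linear_domain[OF L_linear[of 0]])

lemma L_commutator:
  "L m (L n x) - L n (L m x) = s (of_int (m - n)) (L (m + n) x) +
     (if m + n = 0 then s (of_int (m ^ 3 - m) / 12 * c) x else 0)"
  using relations by (simp add: virasoro_relations_def)

lemma L_commute:
  "L m (L n x) = L n (L m x) + s (of_int (m - n)) (L (m + n) x) +
     (if m + n = 0 then s (of_int (m ^ 3 - m) / 12 * c) x else 0)"
  using L_commutator[of m n x] by (simp add: algebra_simps)

lemma submodule_UNIV: "virasoro_submodule s L U \<Longrightarrow> v \<in> U \<Longrightarrow> U = UNIV"
  using hull_minimal[of "{v}" U "virasoro_submodule s L"] cyclic by auto

text \<open>Straightening with all complex coefficients, where integrality is no restriction, makes
  the span of the words a submodule; it contains \<open>v\<close>, which generates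
  everything.\<close>

lemma span_lowering_words: "span (lowering_words (\<lambda>_::unit. L) UNIV v) = UNIV"
proof (rule submodule_UNIV)
  let ?N = "lowering_words (\<lambda>_::unit. L) UNIV v"
  have "L n x \<in> span ?N" if x: "x \<in> span ?N" for n x
    unfolding span_def coeff_submodule_UNIV[OF vector_space_axioms, symmetric]
  proof (rule lowering_words_hull_closed[where L="\<lambda>_::unit. L" and t="()"])
    show "\<exists>r\<in>UNIV :: unit set. \<exists>z\<in>UNIV. L m (L n w) = L n (L m w) + s (of_int (m - n)) (L (m + n) w) + s z w"
      for m n w
      unfolding L_commute[of m n w]
      by (rule bexI[of _ "()"], rule bexI[of _ "if m + n = 0 then of_int (m ^ 3 - m) / 12 * c else 0"]) auto
    show "x \<in> coeff_submodule s UNIV hull ?N"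
      using x unfolding span_def coeff_submodule_UNIV[OF vector_space_axioms] .
  qed (auto simp: L_linear v_pos v_zero)
  then show "virasoro_submodule s L (span ?N)"
    by (simp add: virasoro_submodule_def)
  show "v \<in> span ?N"
    by (intro span_base lowering_words.base)
qed

text \<open>Project to weight \<open>h\<close> and take a coordinate at \<open>v\<close>. On a word
  \<open>w\<close> of weight \<open>h + k\<close>, the vector \<open>L n w\<close> with
  \<open>n < 0\<close> satisfies the eigenvalue equation for \<open>h + k - n\<close>, which differs
  from \<open>h\<close>; and words span.\<close>

lemma lowest_functional:
  obtains l where "Vector_Spaces.linear s (*) l" "l v = 1" "\<And>n x. n < 0 \<Longrightarrow> l (L n x) = 0"
proof -
  have sub: "subspace {w. L 0 w = s k w}" for k
    by (auto simp: subspace_def linear_rules[OF L_linear] scale_right_distrib mult.commute)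
  obtain \<pi> where \<pi>: "Vector_Spaces.linear s s (\<pi> k)" "L 0 x = s k x \<Longrightarrow> \<pi> k x = x"
    "L 0 x = s k x \<Longrightarrow> k \<noteq> j \<Longrightarrow> \<pi> j x = 0" for k j x
    by (rule direct_sum_projections[OF vector_space_axioms sub grading]) auto
  have ind: "independent {v}"
    using v_nonzero by simp
  define B where "B = extend_basis {v}"
  have B: "independent B" "span B = UNIV" "v \<in> B"
    using independent_extend_basis[OF ind] span_extend_basis[OF ind] extend_basis_superset[OF ind]
    by (auto simp: B_def)
  define l where "l x = representation B (\<pi> h x) v" for x
  have lin: "Vector_Spaces.linear s (*) l"
    using Vector_Spaces.linear_compose[OF \<pi>(1)[of h] linear_representation[OF B(1,2)]]
    by (simp add: l_def[abs_def] o_def)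
  have "l (L n x) = 0" if n: "n < 0" for n x
  proof -
    have "(l \<circ> L n) x = 0"
    proof (rule linear_eq_on_spanning[OF _ _ span_lowering_words])
      show "Vector_Spaces.linear s (*) (l \<circ> L n)"
        by (rule Vector_Spaces.linear_compose[OF L_linear lin])
      show "Vector_Spaces.linear s (*) (\<lambda>x. 0)"
        by (simp add: Vector_Spaces.linear_iff vector_space_axioms vector_space_complex)
      fix w assume "w \<in> lowering_words (\<lambda>_::unit. L) UNIV v"
      then have "\<exists>k::nat. L 0 w = s (h + of_nat k) w"
        by (rule lowering_words_weight[rotated -1]) (auto simp: L_linear v_zero L_commute[of 0])
      then obtain k :: nat where k: "L 0 w = s (h + of_nat k) w" ..
      have "L 0 (L n w) = s (h + of_nat k - of_int n) (L n w)"
        by (simp add: L_commute[of 0 n] k linear_rule_scale[OF L_linear] scale_left_diff_distrib)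
      moreover have "h + of_nat k - of_int n \<noteq> h"
      proof
        assume "h + of_nat k - of_int n = h"
        then have "of_int (int k - n) = (0 :: complex)"
          by simp
        then show False
          using n by (simp only: of_int_eq_0_iff)
      qed
      ultimately have "\<pi> h (L n w) = 0"
        by (rule \<pi>(3))
      then show "(l \<circ> L n) w = 0"
        by (simp add: l_def representation_zero)
    qed
    then show ?thesis by simp
  qed
  moreover have "l v = 1"
    using \<pi>(2)[OF v_zero] representation_basis[OF B(1) B(3)] by (simp add: l_def)
  ultimately show ?thesis
    using that lin by blast
qed

end

locale lowest_weight_tensor_power = lowest_weight_module s L c h v
  for s :: "complex \<Rightarrow> 'a::ab_group_add \<Rightarrow> 'a" and L c h v +
  fixes sT :: "complex \<Rightarrow> 't::ab_group_add \<Rightarrow> 't" and \<tau> :: "('i::finite \<Rightarrow> 'a) \<Rightarrow> 't"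
    and LT :: "'i \<Rightarrow> int \<Rightarrow> 't \<Rightarrow> 't"
  assumes tensor: "is_tensor_power s sT \<tau>"
    and LT_linear: "Vector_Spaces.linear sT sT (LT i n)"
    and LT_tensor: "LT i n (\<tau> f) = \<tau> (f(i := L n (f i)))"
begin

sublocale T: vector_space sT
  by (rule tensor_power_vector_spaces(2)[OF tensor])

lemma LT_commute:
  "LT i m (LT j n x) = LT j n (LT i m x) +
     (if i = j then sT (of_int (m - n)) (LT i (m + n) x) +
        (if m + n = 0 then sT (of_int (m ^ 3 - m) / 12 * c) x else 0) else 0)"
proof (rule tensor_power_eqI[OF tensor, where
      g = "\<lambda>x. LT i m (LT j n x)" and
      g' = "\<lambda>x. LT j n (LT i m x) +
        (if i = j then sT (of_int (m - n)) (LT i (m + n) x) +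
          (if m + n = 0 then sT (of_int (m ^ 3 - m) / 12 * c) x else 0) else 0)"])
  note rules = linear_rules[OF LT_linear]
  show "Vector_Spaces.linear sT sT (\<lambda>x. LT i m (LT j n x))"
    by (simp add: Vector_Spaces.linear_iff T.vector_space_axioms rules)
  show "Vector_Spaces.linear sT sT (\<lambda>x. LT j n (LT i m x) +
     (if i = j then sT (of_int (m - n)) (LT i (m + n) x) +
        (if m + n = 0 then sT (of_int (m ^ 3 - m) / 12 * c) x else 0) else 0))"
    by (auto simp: Vector_Spaces.linear_iff T.vector_space_axioms rules T.scale_right_distrib mult.commute)
  fix f
  note tau = linear_rules[OF tensor_power_linear[OF tensor, of f i]]
  show "LT i m (LT j n (\<tau> f)) = LT j n (LT i m (\<tau> f)) +
     (if i = j then sT (of_int (m - n)) (LT i (m + n) (\<tau> f)) +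
        (if m + n = 0 then sT (of_int (m ^ 3 - m) / 12 * c) (\<tau> f) else 0) else 0)"
  proof (cases "i = j")
    case True
    have "\<tau> (f(i := L m (L n (f i)))) = \<tau> (f(i := L n (L m (f i)))) +
        (sT (of_int (m - n)) (\<tau> (f(i := L (m + n) (f i)))) +
        (if m + n = 0 then sT (of_int (m ^ 3 - m) / 12 * c) (\<tau> (f(i := f i))) else 0))"
      unfolding L_commute[of m n] by (simp only: tau if_distrib[of "\<lambda>x. \<tau> (f(i := x))"] add.assoc)
    then show ?thesis
      using True by (simp add: LT_tensor)
  next
    case False
    then show ?thesis
      by (simp add: LT_tensor fun_upd_twist)
  qed
qed

text \<open>The slots are filled one at a time: with all other entries fixed, the vectors that may
  be put into slot \<open>i\<close> form a Virasoro submodule containing \<open>v\<close>.\<close>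

lemma tensor_cyclic:
  assumes K: "T.subspace K" "\<tau> (\<lambda>_. v) \<in> K" "\<And>i n x. x \<in> K \<Longrightarrow> LT i n x \<in> K"
  shows "K = UNIV"
proof -
  have "\<tau> f \<in> K" if "finite J" "\<And>j. j \<notin> J \<Longrightarrow> f j = v" for J f
    using that
  proof (induction J arbitrary: f rule: finite_induct)
    case empty
    then have "f = (\<lambda>_. v)" by auto
    then show ?case using K by simp
  next
    case (insert i J)
    have "{x. \<tau> (f(i := x)) \<in> K} = UNIV"
    proof (rule submodule_UNIV)
      show "v \<in> {x. \<tau> (f(i := x)) \<in> K}"
        using insert by simp
      show "virasoro_submodule s L {x. \<tau> (f(i := x)) \<in> K}"
        unfolding virasoro_submodule_def
      proof (intro conjI allI ballI)
        show "subspace {x. \<tau> (f(i := x)) \<in> K}"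
          using K(1) by (auto simp: subspace_def T.subspace_def linear_rules[OF tensor_power_linear[OF tensor]])
        fix n u assume "u \<in> {x. \<tau> (f(i := x)) \<in> K}"
        then have "LT i n (\<tau> (f(i := u))) \<in> K" using K(3) by simp
        then show "L n u \<in> {x. \<tau> (f(i := x)) \<in> K}" by (simp add: LT_tensor)
      qed
    qed
    then have "\<tau> (f(i := f i)) \<in> K" by blast
    then show ?case by simp
  qed
  from this[of UNIV] have "range \<tau> \<subseteq> K" by auto
  then show ?thesis
    using T.span_minimal[OF _ K(1)] tensor_power_span[OF tensor] by auto
qed

text \<open>Induction on the coordinates where \<open>F\<close> differs from \<open>l\<close>: contracting all coordinates but one
  maps \<open>K\<close> onto a Virasoro submodule of the factor, which is proper since \<open>l\<close> vanishes on it.\<close>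

lemma product_functional_vanishes:
  assumes l: "Vector_Spaces.linear s (*) l" "l v \<noteq> 0"
    and K: "T.subspace K" "\<And>i n x. x \<in> K \<Longrightarrow> LT i n x \<in> K"
    and g0: "Vector_Spaces.linear sT (*) g0" "\<And>f. g0 (\<tau> f) = (\<Prod>i\<in>UNIV. l (f i))"
      "\<And>x. x \<in> K \<Longrightarrow> g0 x = 0"
    and "finite J" "\<And>j. j \<notin> J \<Longrightarrow> F j = l" "\<And>j. Vector_Spaces.linear s (*) (F j)"
      "Vector_Spaces.linear sT (*) g" "\<And>f. g (\<tau> f) = (\<Prod>i\<in>UNIV. F i (f i))" "x \<in> K"
  shows "g x = 0"
  using assms(8-13)
proof (induction J arbitrary: F g x rule: finite_induct)
  case empty
  have "g x = g0 x"
    by (rule tensor_power_eqI[OF tensor empty(3) g0(1)]) (simp add: empty g0)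
  then show ?case using g0(3) empty by simp
next
  case (insert i J)
  obtain con where con: "Vector_Spaces.linear sT s con"
    "\<And>f. con (\<tau> f) = s (\<Prod>j\<in>-{i}. F j (f j)) (f i)"
    by (rule tensor_contraction[where F=F and i=i, OF tensor insert.prems(2)], rule that)
  \<comment> \<open>A product functional that agrees with \<open>F\<close> outside slot
    \<open>i\<close> factors through the contraction. This is applied with \<open>p = l\<close> and
    with \<open>p = F i\<close>.\<close>
  have con_eq: "k y = p (con y)"
    if k: "Vector_Spaces.linear sT (*) k" "\<And>f. k (\<tau> f) = (\<Prod>j\<in>UNIV. (F(i := p)) j (f j))"
      and p: "Vector_Spaces.linear s (*) p" for k p y
  proof -
    have "k y = (p \<circ> con) y"
    proof (rule tensor_power_eqI[OF tensor k(1) Vector_Spaces.linear_compose[OF con(1) p]])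
      fix f
      have "k (\<tau> f) = p (f i) * (\<Prod>j\<in>UNIV - {i}. (F(i := p)) j (f j))"
        unfolding k(2) by (subst prod.remove[of _ i]) auto
      also have "(\<Prod>j\<in>UNIV - {i}. (F(i := p)) j (f j)) = (\<Prod>j\<in>-{i}. F j (f j))"
        by (rule prod.cong) auto
      finally show "k (\<tau> f) = (p \<circ> con) (\<tau> f)"
        by (simp add: con(2) linear_rule_scale[OF p] mult.commute)
    qed
    then show ?thesis by simp
  qed
  have lin': "Vector_Spaces.linear s (*) ((F(i := l)) j)" for j
    using insert.prems(2) l(1) by simp
  obtain g' where g': "Vector_Spaces.linear sT (*) g'"
    "\<And>f. g' (\<tau> f) = (\<Prod>j\<in>UNIV. (F(i := l)) j (f j))"
    by (rule product_functional[where F="F(i := l)", OF tensor lin'], rule that)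
  have l_con: "l (con y) = 0" if "y \<in> K" for y
  proof -
    have "g' y = 0"
      by (rule insert.IH[OF _ lin' g' that]) (use insert.prems(1) in auto)
    then show ?thesis
      using con_eq[OF g' l(1)] by simp
  qed
  have L_con: "L n (con y) = con (LT i n y)" for n y
  proof -
    have "(L n \<circ> con) y = (con \<circ> LT i n) y"
    proof (rule tensor_power_eqI[OF tensor Vector_Spaces.linear_compose[OF con(1) L_linear]
          Vector_Spaces.linear_compose[OF LT_linear con(1)]])
      fix f
      have "(\<Prod>j\<in>-{i}. F j ((f(i := L n (f i))) j)) = (\<Prod>j\<in>-{i}. F j (f j))"
        by (rule prod.cong) auto
      then show "(L n \<circ> con) (\<tau> f) = (con \<circ> LT i n) (\<tau> f)"
        by (simp add: con(2) LT_tensor linear_rule_scale[OF L_linear])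
    qed
    then show ?thesis by simp
  qed
  have "virasoro_submodule s L (con ` K)"
    unfolding virasoro_submodule_def
  proof (intro conjI allI ballI)
    interpret con: Vector_Spaces.linear sT s con by (rule con(1))
    show "subspace (con ` K)"
      by (rule con.subspace_image[OF K(1)])
    show "L n u \<in> con ` K" if "u \<in> con ` K" for n u
      using that K(2) by (auto simp: L_con)
  qed
  moreover have "v \<notin> con ` K"
    using l_con l(2) by auto
  ultimately have "con ` K = {0}"
    using irreducible by blast
  then have "con x = 0"
    using insert.prems(5) by auto
  moreover have "g x = F i (con x)"
    by (rule con_eq) (use insert.prems in auto)
  ultimately show ?case
    using linear_rule_zero[OF insert.prems(2)] by simp
qed

text \<open>The last property is the form in which irreducibility of the factors is used: the kernel
  of \<open>l\<close> contains no nonzero subspace stable under all single-factor modes. On such a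
  subspace all product functionals vanish, and these separate points.\<close>

lemma tensor_functional:
  obtains l where "Vector_Spaces.linear sT (*) l" "l (\<tau> (\<lambda>_. v)) = 1"
    "\<And>i n x. n < 0 \<Longrightarrow> l (LT i n x) = 0"
    "\<And>K x. T.subspace K \<Longrightarrow> (\<And>i n x. x \<in> K \<Longrightarrow> LT i n x \<in> K) \<Longrightarrow> (\<And>x. x \<in> K \<Longrightarrow> l x = 0) \<Longrightarrow>
      x \<in> K \<Longrightarrow> x = 0"
proof -
  obtain l0 where l0: "Vector_Spaces.linear s (*) l0" "l0 v = 1" "\<And>n x. n < 0 \<Longrightarrow> l0 (L n x) = 0"
    using lowest_functional by blast
  obtain l where l: "Vector_Spaces.linear sT (*) l" "\<And>f. l (\<tau> f) = (\<Prod>i\<in>UNIV. l0 (f i))"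
    by (rule product_functional[where F="\<lambda>_. l0", OF tensor l0(1)], rule that)
  show ?thesis
  proof (rule that[OF l(1)])
    show "l (\<tau> (\<lambda>_. v)) = 1"
      by (simp add: l l0)
    show "l (LT i n x) = 0" if n: "n < 0" for i n x
    proof -
      have "(l \<circ> LT i n) x = 0"
      proof (rule tensor_power_eqI[OF tensor Vector_Spaces.linear_compose[OF LT_linear l(1)]])
        show "Vector_Spaces.linear sT (*) (\<lambda>x. 0)"
          by (simp add: Vector_Spaces.linear_iff T.vector_space_axioms vector_space_complex)
        show "(l \<circ> LT i n) (\<tau> f) = 0" for f
          using l0(3)[OF n] by (auto simp: LT_tensor l(2) intro!: prod_zero)
      qed
      then show ?thesis by simp
    qed
    show "x = 0" if K: "T.subspace K" "\<And>i n x. x \<in> K \<Longrightarrow> LT i n x \<in> K" "\<And>x. x \<in> K \<Longrightarrow> l x = 0"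
        and x: "x \<in> K" for K x
    proof (rule tensor_coordinates_zero[OF tensor])
      fix F g
      assume F: "\<And>i. Vector_Spaces.linear s (*) (F i)" "Vector_Spaces.linear sT (*) g"
        "\<And>f. g (\<tau> f) = (\<Prod>i\<in>UNIV. F i (f i))"
      show "g x = 0"
        by (rule product_functional_vanishes[where F=F and J=UNIV and l=l0, OF l0(1) _ K(1,2) l K(3) _ _ F x])
          (simp_all add: l0)
    qed
  qed
qed

end

section \<open>The lattice attached to a code\<close>

text \<open>For fixed \<open>i\<close> this is a character of the code under symmetric difference.
  Multiplicativity gives the commutator its shape, and orthogonality allows inversion.\<close>

definition code_sign :: "'i set \<Rightarrow> 'i \<Rightarrow> complex" where
  "code_sign S i = (if i \<in> S then - 1 else 1)"

lemma code_sign_sym_diff: "code_sign (sym_diff S T) i = code_sign S i * code_sign T i"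
  by (auto simp: code_sign_def)

lemma code_sign_square: "code_sign S i * code_sign S i = 1"
  by (simp add: code_sign_def)

lemma sum_code_sign:
  "(\<Sum>i\<in>UNIV. code_sign S i) = of_nat CARD('i::finite) - 2 * of_nat (card (S :: 'i set))"
proof -
  have "(\<Sum>i\<in>UNIV. code_sign S i) = (\<Sum>i\<in>S. code_sign S i) + (\<Sum>i\<in>-S. code_sign S i)"
    by (subst sum.union_disjoint[symmetric]) auto
  also have "\<dots> = of_nat (card (- S)) - of_nat (card S)"
    by (simp add: code_sign_def)
  also have "of_nat (card (- S)) = (of_nat CARD('i) - of_nat (card S) :: complex)"
    by (simp only: Compl_eq_Diff_UNIV card_Diff_subset[OF finite subset_UNIV]
        of_nat_diff[OF card_mono[OF finite subset_UNIV]])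
  finally show ?thesis
    by simp
qed

text \<open>This removes a factor 6 from the denominator 12 of the Virasoro central term, which
  explains the \<open>c / 2\<close> in the integrality condition on the code.\<close>

lemma six_dvd_cube_diff: "(6 :: int) dvd m ^ 3 - m"
proof -
  have "(m ^ 3 - m) mod 6 = (m ^ 3 mod 6 - m mod 6) mod 6"
    by (rule mod_diff_eq[symmetric])
  also have "m ^ 3 mod 6 = (m mod 6) ^ 3 mod 6"
    by (rule power_mod[symmetric])
  also have "((m mod 6) ^ 3 mod 6 - m mod 6) mod 6 = ((m mod 6) ^ 3 - m mod 6) mod 6"
    by (rule mod_diff_left_eq)
  also have "((m mod 6) ^ 3 - m mod 6) mod 6 = 0"
  proof -
    have "0 \<le> m mod 6" "m mod 6 < 6" by simp_all
    then consider "m mod 6 = 0" | "m mod 6 = 1" | "m mod 6 = 2" | "m mod 6 = 3" | "m mod 6 = 4" | "m mod 6 = 5"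
      by linarith
    then show ?thesis by cases simp_all
  qed
  finally show ?thesis by (simp add: dvd_eq_mod_eq_0)
qed

text \<open>Translation by \<open>S0\<close> permutes the code and negates every summand, so the sum
  equals its own negative.\<close>

lemma code_sign_orthogonal:
  fixes C :: "'i::finite set set"
  assumes C: "binary_linear_code C" and S0: "S0 \<in> C" "i \<in> S0 \<longleftrightarrow> j \<notin> S0"
  shows "(\<Sum>S\<in>C. code_sign S i * code_sign S j) = 0"
proof -
  have inv: "sym_diff (sym_diff S S0) S0 = S" for S
    by blast
  have mem: "sym_diff S S0 \<in> C" if "S \<in> C" for S
    using C S0(1) that by (simp add: binary_linear_code_def)
  have "(\<Sum>S\<in>C. code_sign S i * code_sign S j) =
      (\<Sum>S\<in>C. code_sign (sym_diff S S0) i * code_sign (sym_diff S S0) j)"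
    by (rule sum.reindex_bij_witness[of _ "\<lambda>S. sym_diff S S0" "\<lambda>S. sym_diff S S0"])
      (simp_all only: inv mem)
  also have "\<dots> = (\<Sum>S\<in>C. (code_sign S0 i * code_sign S0 j) * (code_sign S i * code_sign S j))"
    by (simp only: code_sign_sym_diff mult_ac)
  also have "code_sign S0 i * code_sign S0 j = - 1"
    using S0(2) by (auto simp: code_sign_def)
  finally show ?thesis
    by (simp add: sum_negf)
qed

inductive_set composed_functionals ::
  "('a \<Rightarrow> complex) \<Rightarrow> ('b \<Rightarrow> int \<Rightarrow> 'a \<Rightarrow> 'a) \<Rightarrow> 'b set \<Rightarrow> ('a \<Rightarrow> complex) set"
  for l :: "'a \<Rightarrow> complex" and L :: "'b \<Rightarrow> int \<Rightarrow> 'a \<Rightarrow> 'a" and C :: "'b set" where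
  base: "l \<in> composed_functionals l L C"
| step: "\<phi> \<in> composed_functionals l L C \<Longrightarrow> t \<in> C \<Longrightarrow> \<phi> \<circ> L t n \<in> composed_functionals l L C"

locale code_lattice = lowest_weight_tensor_power s L c h v sT \<tau> LT
  for s :: "complex \<Rightarrow> 'a::ab_group_add \<Rightarrow> 'a" and L c h v
    and sT :: "complex \<Rightarrow> 't::ab_group_add \<Rightarrow> 't" and \<tau> :: "('i::finite \<Rightarrow> 'a) \<Rightarrow> 't" and LT +
  fixes C :: "'i set set"
  assumes linear_code: "binary_linear_code C"
    and separating: "i \<noteq> j \<Longrightarrow> \<exists>S\<in>C. i \<in> S \<longleftrightarrow> j \<notin> S"
    and charge_integral: "S \<in> C \<Longrightarrow> c / 2 * (\<Sum>i\<in>UNIV. code_sign S i) \<in> \<int>"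
    and weight_integral: "S \<in> C \<Longrightarrow> h * (\<Sum>i\<in>UNIV. code_sign S i) \<in> \<int>"
    and tensor_grading:
      "internal_direct_sum (\<lambda>k. {w. (\<Sum>i\<in>UNIV. LT i 0 w) = sT k w}) UNIV"
    and tensor_finite_dim:
      "\<exists>B. finite B \<and> {w. (\<Sum>i\<in>UNIV. LT i 0 w) = sT k w} \<subseteq> module.span sT B"
begin

lemma empty_in_code: "{} \<in> C"
  using linear_code by (simp add: binary_linear_code_def)

lemma sym_diff_in_code: "S \<in> C \<Longrightarrow> U \<in> C \<Longrightarrow> sym_diff S U \<in> C"
  using linear_code by (simp add: binary_linear_code_def)

definition code_op :: "'i set \<Rightarrow> int \<Rightarrow> 't \<Rightarrow> 't" where
  "code_op S n x = (\<Sum>i\<in>UNIV. sT (code_sign S i) (LT i n x))"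

abbreviation "lowest \<equiv> \<tau> (\<lambda>_. v)"

definition lattice :: "'t set" where
  "lattice = add_subgroup hull lowering_words code_op C lowest"

lemma code_op_empty: "code_op {} n x = (\<Sum>i\<in>UNIV. LT i n x)"
  by (simp add: code_op_def code_sign_def)

lemma code_op_linear: "Vector_Spaces.linear sT sT (code_op S n)"
  by (simp add: Vector_Spaces.linear_iff T.vector_space_axioms code_op_def linear_rules[OF LT_linear]
      T.scale_right_distrib sum.distrib T.scale_sum_right mult.commute)

text \<open>Operators in different slots commute, so only the diagonal of the double sum
  contributes, and there the two signs multiply to the sign of the symmetric difference.\<close>

lemma code_op_commute:
  "code_op S m (code_op U n x) = code_op U n (code_op S m x) +
     sT (of_int (m - n)) (code_op (sym_diff S U) (m + n) x) +
     (if m + n = 0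
      then sT (of_int (m ^ 3 - m) / 12 * c * (\<Sum>i\<in>UNIV. code_sign (sym_diff S U) i)) x else 0)"
proof -
  let ?com = "\<lambda>i. sT (of_int (m - n)) (LT i (m + n) x) +
     (if m + n = 0 then sT (of_int (m ^ 3 - m) / 12 * c) x else 0)"
  have expand: "code_op S m (code_op U n x) =
      (\<Sum>i\<in>UNIV. \<Sum>j\<in>UNIV. sT (code_sign S i * code_sign U j) (LT i m (LT j n x)))" for S U m n
    by (simp add: code_op_def linear_rules[OF LT_linear] T.scale_sum_right)
  have "code_op S m (code_op U n x) =
      (\<Sum>i\<in>UNIV. \<Sum>j\<in>UNIV. sT (code_sign S i * code_sign U j) (LT j n (LT i m x)) +
        (if i = j then sT (code_sign S i * code_sign U j) (?com i) else 0))"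
    unfolding expand[of S m U n] by (intro sum.cong refl) (subst LT_commute, simp add: T.scale_right_distrib)
  also have "\<dots> = (\<Sum>i\<in>UNIV. \<Sum>j\<in>UNIV. sT (code_sign S i * code_sign U j) (LT j n (LT i m x))) +
      (\<Sum>i\<in>UNIV. sT (code_sign S i * code_sign U i) (?com i))"
    by (simp only: sum.distrib sum.delta' finite UNIV_I if_True)
  also have "(\<Sum>i\<in>UNIV. \<Sum>j\<in>UNIV. sT (code_sign S i * code_sign U j) (LT j n (LT i m x))) =
      code_op U n (code_op S m x)"
    unfolding expand[of U n S m] by (subst sum.swap) (simp only: mult.commute)
  also have "(\<Sum>i\<in>UNIV. sT (code_sign S i * code_sign U i) (?com i)) =
      sT (of_int (m - n)) (code_op (sym_diff S U) (m + n) x) +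
      (if m + n = 0
       then sT (of_int (m ^ 3 - m) / 12 * c * (\<Sum>i\<in>UNIV. code_sign (sym_diff S U) i)) x else 0)"
    unfolding code_op_def code_sign_sym_diff
    by (simp add: T.scale_right_distrib sum.distrib T.scale_sum_right mult.commute
        sum_distrib_left sum_distrib_right sum_divide_distrib T.scale_sum_left)
  finally show ?thesis
    by (simp only: add.assoc)
qed

lemma code_op_lowest_pos: "n > 0 \<Longrightarrow> code_op S n lowest = 0"
  using tensor_power_zero[OF tensor, of "(\<lambda>_. v)(i := 0)" i for i]
  by (simp add: code_op_def LT_tensor v_pos)

lemma code_op_lowest_zero: "code_op S 0 lowest = sT (h * (\<Sum>i\<in>UNIV. code_sign S i)) lowest"
proof -
  have "LT i 0 lowest = sT h lowest" for i
    using linear_rule_scale[OF tensor_power_linear[OF tensor], of "\<lambda>_. v" i h v]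
    by (simp add: LT_tensor v_zero fun_upd_idem)
  then show ?thesis
    by (simp add: code_op_def sum_distrib_left T.scale_sum_left mult.commute)
qed

lemma code_op_lattice:
  assumes "S \<in> C" "x \<in> lattice"
  shows "code_op S n x \<in> lattice"
  unfolding lattice_def coeff_submodule_Ints[OF T.vector_space_axioms, symmetric]
proof (rule lowering_words_hull_closed[where L=code_op and t=S])
  fix S U w and m n :: int assume SU: "S \<in> C" "U \<in> C"
  obtain q where q: "m ^ 3 - m = 6 * q"
    using six_dvd_cube_diff[of m] by (auto simp: dvd_def)
  define z where
    "z = (if m + n = 0 then of_int (m ^ 3 - m) / 12 * c * (\<Sum>i\<in>UNIV. code_sign (sym_diff S U) i) else 0)"
  have "of_int (m ^ 3 - m) / 12 * c * (\<Sum>i\<in>UNIV. code_sign (sym_diff S U) i) =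
      of_int q * (c / 2 * (\<Sum>i\<in>UNIV. code_sign (sym_diff S U) i))"
    unfolding q by simp
  also have "\<dots> \<in> \<int>"
    by (rule Ints_mult[OF Ints_of_int charge_integral[OF sym_diff_in_code[OF SU]]])
  finally have "z \<in> \<int>"
    by (simp add: z_def)
  moreover have "code_op S m (code_op U n w) = code_op U n (code_op S m w) +
      sT (of_int (m - n)) (code_op (sym_diff S U) (m + n) w) + sT z w"
    unfolding code_op_commute[of S m U n w] z_def by simp
  ultimately show "\<exists>r\<in>C. \<exists>z\<in>\<int>. code_op S m (code_op U n w) = code_op U n (code_op S m w) +
      sT (of_int (m - n)) (code_op r (m + n) w) + sT z w"
    using sym_diff_in_code[OF SU] by blast
next
  show "\<exists>z\<in>\<int>. code_op t 0 lowest = sT z lowest" if "t \<in> C" for t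
    by (rule bexI[of _ "h * (\<Sum>i\<in>UNIV. code_sign t i)"])
      (rule code_op_lowest_zero, rule weight_integral[OF that])
  show "x \<in> coeff_submodule sT \<int> hull lowering_words code_op C lowest"
    using assms(2) unfolding lattice_def coeff_submodule_Ints[OF T.vector_space_axioms] .
qed (use assms(1) code_op_lowest_pos code_op_linear in auto)

text \<open>Fourier inversion on the code: its characters at distinct indices are orthogonal.\<close>

lemma subspace_closed_LT:
  assumes K: "T.subspace K" "\<And>S x. S \<in> C \<Longrightarrow> x \<in> K \<Longrightarrow> code_op S n x \<in> K" and x: "x \<in> K"
  shows "LT i n x \<in> K"
proof -
  have "(\<Sum>S\<in>C. sT (code_sign S i) (code_op S n x)) =
      (\<Sum>j\<in>UNIV. sT (\<Sum>S\<in>C. code_sign S i * code_sign S j) (LT j n x))"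
    unfolding code_op_def T.scale_sum_right T.scale_sum_left T.scale_scale by (rule sum.swap)
  also have "\<dots> = (\<Sum>j\<in>UNIV. if j = i then sT (of_nat (card C)) (LT j n x) else 0)"
  proof (rule sum.cong[OF refl])
    fix j
    show "sT (\<Sum>S\<in>C. code_sign S i * code_sign S j) (LT j n x) =
        (if j = i then sT (of_nat (card C)) (LT j n x) else 0)"
    proof (cases "j = i")
      case True
      then show ?thesis by (simp add: code_sign_square)
    next
      case False
      then obtain S0 where "S0 \<in> C" "i \<in> S0 \<longleftrightarrow> j \<notin> S0"
        using separating[of i j] by auto
      then show ?thesis
        using False code_sign_orthogonal[OF linear_code] by simp
    qed
  qed
  also have "\<dots> = sT (of_nat (card C)) (LT i n x)"
    by simp
  finally have "sT (of_nat (card C)) (LT i n x) \<in> K"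
    using T.subspace_sum[OF K(1), of C "\<lambda>S. sT (code_sign S i) (code_op S n x)"]
      T.subspace_scale[OF K(1)] K(2) x by simp
  then have "sT (inverse (of_nat (card C))) (sT (of_nat (card C)) (LT i n x)) \<in> K"
    by (rule T.subspace_scale[OF K(1)])
  moreover have "card C \<noteq> 0"
    using empty_in_code by auto
  ultimately show ?thesis by simp
qed

section \<open>Generation, complex span and weight decomposition of the lattice\<close>

lemma lattice_add_subgroup: "add_subgroup lattice"
  unfolding lattice_def by (rule add_subgroup_hull)

lemma lowest_in_lattice: "lowest \<in> lattice"
  unfolding lattice_def by (intro hull_inc lowering_words.base)

lemma lattice_minimal:
  assumes "add_subgroup A" "lowest \<in> A" "\<And>S n x. S \<in> C \<Longrightarrow> x \<in> A \<Longrightarrow> code_op S n x \<in> A"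
  shows "lattice \<subseteq> A"
  unfolding lattice_def
proof (rule hull_minimal)
  show "lowering_words code_op C lowest \<subseteq> A"
  proof
    show "x \<in> A" if "x \<in> lowering_words code_op C lowest" for x
      using that by induction (use assms in auto)
  qed
qed (rule assms(1))

text \<open>This turns an integral basis of the lattice into a complex basis of the whole space. The
  span, unlike the lattice, admits Fourier inversion and is thus stable under single-factor
  modes.\<close>

lemma span_lattice: "T.span lattice = UNIV"
proof (rule tensor_cyclic)
  show "lowest \<in> T.span lattice"
    by (intro T.span_base lowest_in_lattice)
  have "code_op S n x \<in> T.span lattice" if S: "S \<in> C" and x: "x \<in> T.span lattice" for S n x
  proof -
    interpret op: Vector_Spaces.linear sT sT "code_op S n" by (rule code_op_linear)
    have "T.span lattice \<subseteq> {y. code_op S n y \<in> T.span lattice}"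
      by (rule T.span_minimal)
        (auto intro: T.span_base code_op_lattice[OF S] op.subspace_linear_preimage)
    then show ?thesis using x by auto
  qed
  then show "LT i n x \<in> T.span lattice" if "x \<in> T.span lattice" for i n x
    using subspace_closed_LT[OF T.subspace_span] that by blast
qed simp

abbreviation "weight k \<equiv> {w. (\<Sum>i\<in>UNIV. LT i 0 w) = sT k w}"

lemma weight_subspace: "T.subspace (weight k)"
  unfolding code_op_empty[symmetric]
  by (auto simp: T.subspace_def linear_rules[OF code_op_linear] T.scale_right_distrib mult.commute)

text \<open>The operator of the empty codeword has all signs positive and is the total
  \<open>L(0)\<close>.\<close>

lemma word_weight:
  assumes "x \<in> lowering_words code_op C lowest"
  shows "\<exists>k. x \<in> weight k"
proof -
  have "\<exists>k::nat. code_op {} 0 x = sT (h * (\<Sum>i\<in>UNIV. code_sign ({} :: 'i set) i) + of_nat k) x"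
    by (rule lowering_words_weight[OF _ _ _ assms])
      (auto simp: code_op_linear code_op_lowest_zero code_op_commute[of "{}" 0])
  then show ?thesis
    by (auto simp: code_op_empty)
qed

lemma weight_lattice_basis:
  "\<exists>B. T.independent B \<and> weight k \<inter> lattice = int_span sT B"
proof -
  obtain l where l: "Vector_Spaces.linear sT (*) l" "l lowest = 1"
    "\<And>i n x. n < 0 \<Longrightarrow> l (LT i n x) = 0"
    "\<And>K x. T.subspace K \<Longrightarrow> (\<And>i n x. x \<in> K \<Longrightarrow> LT i n x \<in> K) \<Longrightarrow> (\<And>x. x \<in> K \<Longrightarrow> l x = 0) \<Longrightarrow>
      x \<in> K \<Longrightarrow> x = 0"
    using tensor_functional by blast
  define \<Phi> where "\<Phi> = composed_functionals l code_op C"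
  have \<Phi>_linear: "Vector_Spaces.linear sT (*) \<phi>" if "\<phi> \<in> \<Phi>" for \<phi>
    using that unfolding \<Phi>_def
  proof induction
    case base
    show ?case by (rule l(1))
  next
    case (step \<phi> t n)
    show ?case by (rule Vector_Spaces.linear_compose[OF code_op_linear step.IH])
  qed
  \<comment> \<open>On the generating words \<open>l\<close> takes only two values: 1 on the empty
    word and 0 on all others, whose leftmost letter is a lowering mode.\<close>
  have l_int: "l x \<in> \<int>" if "x \<in> lattice" for x
    using that unfolding lattice_def
  proof (rule hull_induct)
    show "add_subgroup {x. l x \<in> \<int>}"
      by (auto simp: add_subgroup_def linear_rules[OF l(1)])
    show "l x \<in> \<int>" if "x \<in> lowering_words code_op C lowest" for x
      using that
    proof cases
      case base
      then show ?thesis using l(2) by simp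
    next
      case (step w t n)
      then show ?thesis
        by (simp add: code_op_def linear_rules[OF l(1)] l(3))
    qed
  qed
  have \<Phi>_int: "\<phi> x \<in> \<int>" if "\<phi> \<in> \<Phi>" "x \<in> lattice" for \<phi> x
    using that unfolding \<Phi>_def
    by (induction arbitrary: x) (auto intro: l_int code_op_lattice)
  have \<Phi>_sep: "\<exists>\<phi>\<in>\<Phi>. \<phi> x \<noteq> 0" if "x \<noteq> 0" for x
  proof (rule ccontr)
    assume x: "\<not> (\<exists>\<phi>\<in>\<Phi>. \<phi> x \<noteq> 0)"
    \<comment> \<open>This common kernel is a complex subspace, so stability under the code
      operators passes to single-factor modes; as \<open>l\<close> itself vanishes on it, it must be
      zero.\<close>
    define K where "K = {x. \<forall>\<phi>\<in>\<Phi>. \<phi> x = 0}"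
    have K: "T.subspace K"
      by (auto simp: T.subspace_def K_def linear_rules[OF \<Phi>_linear])
    have "code_op S n y \<in> K" if "S \<in> C" "y \<in> K" for S n y
      using that composed_functionals.step[of _ l code_op C S n] by (fastforce simp: K_def \<Phi>_def)
    then have "LT i n y \<in> K" if "y \<in> K" for i n y
      using subspace_closed_LT[OF K] that by blast
    moreover have "l y = 0" if "y \<in> K" for y
      using that composed_functionals.base[of l code_op C] by (auto simp: K_def \<Phi>_def)
    moreover have "x \<in> K"
      using x by (auto simp: K_def)
    ultimately have "x = 0"
      using l(4)[OF K] by blast
    then show False using that by simp
  qed
  obtain F where F: "finite F" "weight k \<subseteq> T.span F"
    using tensor_finite_dim by blast
  show ?thesis
  proof (rule integral_functionals_imp_lattice[OF T.vector_space_axioms, where \<Phi>=\<Phi>])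
    show "add_subgroup (weight k \<inter> lattice)"
      by (intro add_subgroup_Int subspace_add_subgroup[OF T.vector_space_axioms]
          weight_subspace lattice_add_subgroup)
    show "weight k \<inter> lattice \<subseteq> T.span F"
      using F(2) by blast
  qed (use F(1) \<Phi>_linear \<Phi>_int \<Phi>_sep in auto)
qed

lemma lattice_basis: "\<exists>B. is_basis sT B \<and> lattice = int_span sT B"
proof -
  obtain B where B: "T.independent B" "lattice = int_span sT B"
    using graded_lattice(1)[OF T.vector_space_axioms weight_subspace tensor_grading lattice_def
        word_weight weight_lattice_basis] by blast
  have "T.span B = UNIV"
    using span_lattice span_add_subgroup_hull[OF T.vector_space_axioms, of B]
    by (simp add: B(2) int_span_eq_hull[OF T.vector_space_axioms])
  then show ?thesis
    using B by (auto simp: is_basis_def)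
qed

lemma lattice_grading: "internal_direct_sum (\<lambda>k. weight k \<inter> lattice) lattice"
  by (rule graded_lattice(2)[OF T.vector_space_axioms weight_subspace tensor_grading lattice_def
        word_weight weight_lattice_basis])

end

section \<open>Modules for vertex rings\<close>

context voa_module
begin

text \<open>With \<open>p = 0\<close> the Jacobi identity expresses the modes of \<open>u_r v\<close> as integral combinations of
  products of modes of \<open>u\<close> and \<open>v\<close>.\<close>

lemma vertex_ring_submodule_generated:
  assumes M: "add_subgroup M" and G: "\<And>u m x. u \<in> G \<Longrightarrow> x \<in> M \<Longrightarrow> YW u m x \<in> M"
  shows "vertex_ring_submodule YW (vertex_subring YV vac hull G) M"
proof -
  \<comment> \<open>The stabilizer of \<open>M\<close> is itself a vertex subring, hence contains
    the one generated by \<open>G\<close>.\<close>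
  define A where "A = {u. \<forall>m. \<forall>x\<in>M. YW u m x \<in> M}"
  note left = linear_rules[OF linear_left]
  have prod: "YW (YV u r v) q x \<in> M" if uv: "u \<in> A" "v \<in> A" and x: "x \<in> M" for u v r q x
  proof -
    have "YW (YV u r v) q x =
        Sum_any (\<lambda>i::nat. sW (of_int 0 gchoose i) (YW (YV u (r + int i) v) (0 + q - int i) x))"
      by (subst Sum_any.expand_superset[of "{0}"]) (auto simp: gbinomial_0_left)
    also have "\<dots> = Sum_any (\<lambda>i::nat. sW ((-1) ^ i * (of_int r gchoose i))
       (YW u (0 + r - int i) (YW v (q + int i) x)
        - sW ((-1) powi r) (YW v (q + r - int i) (YW u (0 + int i) x))))"
      using jacobi unfolding jacobi_identity_def by blast
    also have "\<dots> \<in> M"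
    proof (rule add_subgroup_Sum_any[OF M])
      fix i :: nat
      have sign: "(- 1 :: complex) powi r \<in> \<int>"
        by (cases "even r") simp_all
      have "YW u (0 + r - int i) (YW v (q + int i) x) \<in> M" "YW v (q + r - int i) (YW u (0 + int i) x) \<in> M"
        using uv x by (auto simp: A_def)
      then have "YW u (0 + r - int i) (YW v (q + int i) x)
        - sW ((-1) powi r) (YW v (q + r - int i) (YW u (0 + int i) x)) \<in> M"
        by (intro add_subgroup_diff[OF M] add_subgroup_scale_Ints[OF W.vector_space_axioms M] sign)
      \<comment> \<open>Here \<open>r\<close> may be negative; generalized binomial coefficients at
        integers are still integers.\<close>
      moreover have "(-1) ^ i * (of_int r gchoose i :: complex) \<in> \<int>"
        by (simp add: of_int_gbinomial[symmetric])
      ultimately show "sW ((-1) ^ i * (of_int r gchoose i))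
       (YW u (0 + r - int i) (YW v (q + int i) x)
        - sW ((-1) powi r) (YW v (q + r - int i) (YW u (0 + int i) x))) \<in> M"
        by (intro add_subgroup_scale_Ints[OF W.vector_space_axioms M])
    qed
    finally show ?thesis .
  qed
  have "vertex_subring YV vac A"
    unfolding vertex_subring_def
  proof (intro conjI ballI allI)
    show "add_subgroup A"
      using M by (auto simp: A_def add_subgroup_def left)
    show "vac \<in> A"
      using M by (auto simp: A_def vacuum add_subgroup_def)
    show "YV u r v \<in> A" if "u \<in> A" "v \<in> A" for u v r
      using prod[OF that] by (auto simp: A_def)
  qed
  moreover have "G \<subseteq> A"
    using G by (auto simp: A_def)
  ultimately have "vertex_subring YV vac hull G \<subseteq> A"
    by (intro hull_minimal)
  then show ?thesis
    using M by (auto simp: vertex_ring_submodule_def A_def)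
qed

end

context tensor_power_module
begin

text \<open>The vacuum has only the mode -1, so outside slot \<open>i\<close> every
  \<open>k j\<close> must be -1 and contributes 0 to the degree condition; this forces
  \<open>k i = n + 1\<close>. The shift by 1 is the one between \<open>L(n)\<close> and the modes of
  the conformal vector.\<close>

lemma conf_at_mode:
  "YTW (conf_at \<tau>V vac conf i) (n + 1) (\<tau>W w) = \<tau>W (w(i := virasoro_op YW conf n (w i)))"
proof -
  define u where "u = (\<lambda>_. vac)(i := conf)"
  define k0 :: "'i \<Rightarrow> int" where "k0 = (\<lambda>_. -1)(i := n + 1)"
  define g where "g k = (if (\<Sum>j\<in>UNIV. k j + 1) = n + 1 + 1 then \<tau>W (\<lambda>j. YW (u j) (k j) (w j)) else 0)"
    for k :: "'i \<Rightarrow> int"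
  have sum_at: "(\<Sum>j\<in>UNIV. k j + 1) = k i + 1" if "\<And>j. j \<noteq> i \<Longrightarrow> k j = -1" for k :: "'i \<Rightarrow> int"
  proof -
    have "(\<Sum>j\<in>UNIV. k j + 1) = (\<Sum>j\<in>UNIV. if j = i then k i + 1 else 0)"
      using that by (intro sum.cong) auto
    then show ?thesis by simp
  qed
  have "g k = 0" if "k \<noteq> k0" for k
  proof (cases "\<exists>j. j \<noteq> i \<and> k j \<noteq> -1")
    case True
    then obtain j where "j \<noteq> i" "k j \<noteq> -1" by blast
    then have "YW (u j) (k j) (w j) = 0"
      by (simp add: u_def W.vacuum)
    then show ?thesis
      by (simp add: g_def tensor_power_zero[OF module_tensor_power])
  next
    case False
    have "k i \<noteq> n + 1"
    proof
      assume "k i = n + 1"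
      with False have "k j = k0 j" for j
        by (cases "j = i") (auto simp: k0_def)
      with that show False by blast
    qed
    moreover have "(\<Sum>j\<in>UNIV. k j + 1) = k i + 1"
      by (rule sum_at) (use False in blast)
    ultimately show ?thesis
      by (simp add: g_def)
  qed
  then have "Sum_any g = g k0"
    by (subst Sum_any.expand_superset[of "{k0}"]) auto
  moreover have "g k0 = \<tau>W (w(i := virasoro_op YW conf n (w i)))"
  proof -
    have "(\<lambda>j. YW (u j) (k0 j) (w j)) = w(i := virasoro_op YW conf n (w i))"
      by (auto simp: u_def k0_def W.vacuum virasoro_op_def)
    moreover have "(\<Sum>j\<in>UNIV. k0 j + 1) = n + 1 + 1"
      by (subst sum_at) (simp_all add: k0_def)
    ultimately show ?thesis by (simp add: g_def)
  qed
  moreover have "YTW (\<tau>V u) (n + 1) (\<tau>W w) = Sum_any g"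
    using module_tensor_modes unfolding tensor_modes_def g_def by blast
  ultimately show ?thesis
    by (simp add: conf_at_def u_def)
qed

lemma omega_set_mode:
  "YTW (omega_set \<tau>V vac conf S) m x =
     (\<Sum>i\<in>UNIV. sTW (code_sign S i) (YTW (conf_at \<tau>V vac conf i) m x))"
proof -
  note left = linear_rules[OF TW.linear_left]
  let ?f = "\<lambda>i. sTW (code_sign S i) (YTW (conf_at \<tau>V vac conf i) m x)"
  have "sum ?f UNIV = sum ?f (- S) + sum ?f S"
    by (subst sum.union_disjoint[symmetric]) (auto intro: arg_cong[of _ _ "sum ?f"])
  also have "\<dots> = (\<Sum>i\<in>-S. YTW (conf_at \<tau>V vac conf i) m x) - (\<Sum>i\<in>S. YTW (conf_at \<tau>V vac conf i) m x)"
    by (simp add: code_sign_def sum_negf)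
  finally show ?thesis
    by (simp add: omega_set_def left)
qed

lemma weight_space_tensor:
  "weight_space sTW YTW (tensor_conf \<tau>V vac conf) k =
     {w. (\<Sum>i\<in>UNIV. YTW (conf_at \<tau>V vac conf i) (0 + 1) w) = sTW k w}"
  by (simp add: weight_space_def virasoro_op_def tensor_conf_def linear_rules[OF TW.linear_left])

lemma code_integral_form:
  assumes irr: "irreducible_lowest_weight sW c h (virasoro_op YW conf)"
    and v: "module.span sW {v} = weight_space sW YW conf h"
    and C: "binary_linear_code C" "\<And>i j. i \<noteq> j \<Longrightarrow> \<exists>S\<in>C. i \<in> S \<longleftrightarrow> j \<notin> S"
    and charge: "\<And>S. S \<in> C \<Longrightarrow> c / 2 * (of_nat CARD('i) - 2 * of_nat (card S)) \<in> \<int>"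
    and weight: "\<And>S. S \<in> C \<Longrightarrow> h * (of_nat CARD('i) - 2 * of_nat (card S)) \<in> \<int>"
  shows "module_integral_form sTW YTW (tensor_conf \<tau>V vac conf)
           (code_vertex_subring YT \<tau>V vac conf C)
           (vertex_ring_submodule YTW (code_vertex_subring YT \<tau>V vac conf C) hull {\<tau>W (\<lambda>_. v)})"
proof -
  let ?L = "virasoro_op YW conf"
  let ?LT = "\<lambda>i n. YTW (conf_at \<tau>V vac conf i) (n + 1)"
  let ?A = "code_vertex_subring YT \<tau>V vac conf C"
  have lin: "Vector_Spaces.linear sW sW (?L n)" for n
    using W.linear_right[of conf "n + 1"] by (simp add: virasoro_op_def)
  obtain v0 where v0: "v0 \<noteq> 0" "\<And>n. n > 0 \<Longrightarrow> ?L n v0 = 0" "?L 0 v0 = sW h v0"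
    "virasoro_submodule sW ?L hull {v0} = UNIV"
    using irr unfolding irreducible_lowest_weight_def by blast
  \<comment> \<open>The given vector spans the lowest weight space and is therefore proportional to
    the generator \<open>v0\<close> supplied by irreducibility, whose properties it
    inherits.\<close>
  have "v0 \<in> W.W.span {v}"
    using v0(3) by (simp add: v weight_space_def)
  then obtain a where a: "v0 = sW a v"
    by (auto simp: W.W.span_singleton)
  have nz: "a \<noteq> 0"
    using a v0(1) by auto
  have v_eq: "v = sW (inverse a) v0"
    using nz by (simp add: a)
  interpret code_lattice sW ?L c h v sTW \<tau>W ?LT C
  proof (intro code_lattice.intro lowest_weight_tensor_power.intro lowest_weight_module.intro
      lowest_weight_tensor_power_axioms.intro code_lattice_axioms.intro)
    show "virasoro_relations sW c ?L" by (rule W.virasoro)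
    show "v \<noteq> 0" using v0(1) a by auto
    show "?L n v = 0" if "n > 0" for n
      unfolding v_eq by (simp only: linear_rule_scale[OF lin] v0(2)[OF that] W.W.scale_zero_right)
    show "?L 0 v = sW h v"
      using W.W.span_base[of v "{v}"] by (simp add: v weight_space_def)
    show "virasoro_submodule sW ?L hull {v} = UNIV"
    proof -
      have "U = UNIV" if U: "virasoro_submodule sW ?L U" "v \<in> U" for U
      proof -
        have "v0 \<in> U"
          using U W.W.subspace_scale unfolding a virasoro_submodule_def by blast
        then show ?thesis
          using hull_minimal[of "{v0}" U "virasoro_submodule sW ?L"] U(1) v0(4) by auto
      qed
      then show ?thesis by (auto simp: hull_def)
    qed
    show "U = {0} \<or> U = UNIV" if "virasoro_submodule sW ?L U" for U
      using irr that unfolding irreducible_lowest_weight_def by blast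
    show "internal_direct_sum (\<lambda>k. {w. ?L 0 w = sW k w}) UNIV"
      using W.grading by (simp add: weight_space_def[abs_def])
    show "is_tensor_power sW sTW \<tau>W" by (rule module_tensor_power)
    show "Vector_Spaces.linear sTW sTW (?LT i n)" for i n by (rule TW.linear_right)
    show "?LT i n (\<tau>W f) = \<tau>W (f(i := ?L n (f i)))" for i n f by (rule conf_at_mode)
    show "internal_direct_sum (\<lambda>k. {w. (\<Sum>i\<in>UNIV. ?LT i 0 w) = sTW k w}) UNIV"
      using TW.grading unfolding weight_space_tensor[abs_def] .
    show "\<exists>B. finite B \<and> {w. (\<Sum>i\<in>UNIV. ?LT i 0 w) = sTW k w} \<subseteq> TW.W.span B" for k
      using TW.finite_dim unfolding weight_space_tensor .
  qed (use C charge weight in \<open>simp_all only: sum_code_sign\<close>)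
  have op: "code_op S n = YTW (omega_set \<tau>V vac conf S) (n + 1)" for S n
    by (rule ext) (simp add: code_op_def omega_set_mode)
  have omega: "YTW (omega_set \<tau>V vac conf S) m x = code_op S (m - 1) x" for S m x
    by (simp add: op)
  have submodule: "vertex_ring_submodule YTW ?A lattice"
    unfolding code_vertex_subring_def
    by (rule TW.vertex_ring_submodule_generated[OF lattice_add_subgroup])
      (auto simp: omega intro: code_op_lattice)
  \<comment> \<open>The lattice is stable under the whole vertex ring by the Jacobi identity;
    conversely every submodule is stable under the modes of the generators
    \<open>\<omega>_S\<close>.\<close>
  have hull: "vertex_ring_submodule YTW ?A hull {\<tau>W (\<lambda>_. v)} = lattice"
  proof (rule hull_unique)
    show "{\<tau>W (\<lambda>_. v)} \<subseteq> lattice"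
      using lowest_in_lattice by simp
    show "vertex_ring_submodule YTW ?A lattice"
      by (rule submodule)
    fix M assume M: "{\<tau>W (\<lambda>_. v)} \<subseteq> M" "vertex_ring_submodule YTW ?A M"
    have "omega_set \<tau>V vac conf S \<in> ?A" if "S \<in> C" for S
      unfolding code_vertex_subring_def using that by (intro hull_inc) auto
    then show "lattice \<subseteq> M"
      using M by (intro lattice_minimal) (auto simp: op vertex_ring_submodule_def)
  qed
  show ?thesis
    unfolding hull module_integral_form_def weight_space_tensor
    using submodule lattice_basis lattice_grading by blast
qed

end

section \<open>The code of length 16\<close>

lemma UNIV_8: "(UNIV :: 8 set) = {1, 2, 3, 4, 5, 6, 7, 8}"
proof -
  have "card {1, 2, 3, 4, 5, 6, 7, 8 :: 8} = CARD(8)"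
    by simp
  then show ?thesis
    by (intro card_eq_UNIV_imp_eq_UNIV[symmetric]) auto
qed

lemma all_8: "(\<forall>x::8. P x) \<longleftrightarrow> P 1 \<and> P 2 \<and> P 3 \<and> P 4 \<and> P 5 \<and> P 6 \<and> P 7 \<and> P 8"
proof -
  have "(\<forall>x::8. P x) \<longleftrightarrow> (\<forall>x\<in>UNIV. P x)" by simp
  then show ?thesis
    unfolding UNIV_8 by simp
qed

lemma set_eq_8:
  "(S :: 8 set) = T \<longleftrightarrow> (1 \<in> S \<longleftrightarrow> 1 \<in> T) \<and> (2 \<in> S \<longleftrightarrow> 2 \<in> T) \<and> (3 \<in> S \<longleftrightarrow> 3 \<in> T) \<and> (4 \<in> S \<longleftrightarrow> 4 \<in> T) \<and>
    (5 \<in> S \<longleftrightarrow> 5 \<in> T) \<and> (6 \<in> S \<longleftrightarrow> 6 \<in> T) \<and> (7 \<in> S \<longleftrightarrow> 7 \<in> T) \<and> (8 \<in> S \<longleftrightarrow> 8 \<in> T)"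
  unfolding set_eq_iff all_8 ..

text \<open>The code is self-dual: the four parity checks are orthogonality to \<open>{1,2,3,4}\<close>, \<open>{1,2,5,6}\<close>,
  \<open>{1,3,5,7}\<close> and \<open>{5,6,7,8}\<close>.\<close>

lemma hamming_code_iff:
  "T \<in> hamming_code \<longleftrightarrow>
    ((1 \<in> T \<longleftrightarrow> 2 \<in> T) \<longleftrightarrow> (3 \<in> T \<longleftrightarrow> 4 \<in> T)) \<and> ((1 \<in> T \<longleftrightarrow> 2 \<in> T) \<longleftrightarrow> (5 \<in> T \<longleftrightarrow> 6 \<in> T)) \<and>
    ((1 \<in> T \<longleftrightarrow> 3 \<in> T) \<longleftrightarrow> (5 \<in> T \<longleftrightarrow> 7 \<in> T)) \<and> ((5 \<in> T \<longleftrightarrow> 6 \<in> T) \<longleftrightarrow> (7 \<in> T \<longleftrightarrow> 8 \<in> T))"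
proof -
  \<comment> \<open>Positions 1, 2, 3 and 5 form an information set: the parity checks determine the
    other four bits from them.\<close>
  show ?thesis
    by (simp add: hamming_code_def set_eq_8)
      (cases "1 \<in> T"; cases "2 \<in> T"; cases "3 \<in> T"; cases "5 \<in> T"; simp; blast)
qed

text \<open>Each parity check says that four bits add up to 0 modulo 2, and such conditions are
  additive.\<close>

lemma hamming_code_sym_diff:
  assumes "S \<in> hamming_code" "T \<in> hamming_code"
  shows "sym_diff S T \<in> hamming_code"
proof -
  have mem: "i \<in> sym_diff S T \<longleftrightarrow> ((i \<in> S) \<noteq> (i \<in> T))" for i
    by auto
  have parity: "(((a \<noteq> a') \<longleftrightarrow> (b \<noteq> b')) \<longleftrightarrow> ((d \<noteq> d') \<longleftrightarrow> (e \<noteq> e')))"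
    if "(a \<longleftrightarrow> b) \<longleftrightarrow> (d \<longleftrightarrow> e)" "(a' \<longleftrightarrow> b') \<longleftrightarrow> (d' \<longleftrightarrow> e')" for a a' b b' d d' e e'
    using that by (cases a; cases a'; cases b; cases b'; simp)
  show ?thesis
    using assms unfolding hamming_code_iff mem
    by (elim conjE) (intro conjI parity; assumption)
qed

lemma card_hamming_code:
  assumes "T \<in> hamming_code"
  shows "card T \<in> {0, 4, 8}"
  using assms by (auto simp: hamming_code_def Compl_eq_Diff_UNIV card_Diff_subset)

lemma hamming_code_separates:
  assumes "i \<noteq> j"
  shows "\<exists>T\<in>hamming_code. i \<in> T \<longleftrightarrow> j \<notin> T"
proof (rule ccontr)
  assume "\<not> ?thesis"
  then have eq: "i \<in> T \<longleftrightarrow> j \<in> T" if "T \<in> hamming_code" for T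
    using that by blast
  \<comment> \<open>Membership of \<open>i\<close> in these three codewords spells out the binary
    digits of \<open>8 - i\<close>, for \<open>i\<close> from 1 to 8.\<close>
  have sep: "\<forall>i j::8. (i \<in> {1,2,3,4} \<longleftrightarrow> j \<in> {1,2,3,4}) \<longrightarrow> (i \<in> {1,2,5,6} \<longleftrightarrow> j \<in> {1,2,5,6}) \<longrightarrow>
      (i \<in> {1,3,5,7} \<longleftrightarrow> j \<in> {1,3,5,7}) \<longrightarrow> i = j"
    by (simp add: all_8)
  have "{1,2,3,4} \<in> hamming_code" "{1,2,5,6} \<in> hamming_code" "{1,3,5,7} \<in> hamming_code"
    by (simp_all add: hamming_code_def)
  then have "i = j"
    by (intro sep[rule_format] eq)
  then show False
    using assms by contradiction
qed

section \<open>The code of length 16 obtained by doubling\<close>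

definition code16_sets :: "(8 + 8) set set" where
  "code16_sets = {T <+> T | T. T \<in> hamming_code} \<union> {T <+> - T | T. T \<in> hamming_code}"

lemma sym_diff_Plus: "sym_diff (A <+> B) (A' <+> B') = sym_diff A A' <+> sym_diff B B'"
  by auto

lemma code16_sets_linear: "binary_linear_code code16_sets"
proof -
  have "{} \<in> hamming_code"
    by (simp add: hamming_code_iff)
  then have "{} <+> {} \<in> code16_sets"
    unfolding code16_sets_def by blast
  then have "{} \<in> code16_sets"
    by (simp add: Plus_def)
  moreover have "sym_diff X Y \<in> code16_sets" if XY: "X \<in> code16_sets" "Y \<in> code16_sets" for X Y
  proof -
    obtain S where S: "S \<in> hamming_code" "X = S <+> S \<or> X = S <+> - S"
      using XY(1) unfolding code16_sets_def by blast
    obtain T where T: "T \<in> hamming_code" "Y = T <+> T \<or> Y = T <+> - T"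
      using XY(2) unfolding code16_sets_def by blast
    have compl: "sym_diff (- S) T = - sym_diff S T" "sym_diff S (- T) = - sym_diff S T"
      "sym_diff (- S) (- T) = sym_diff S T"
      by auto
    have "sym_diff X Y = sym_diff S T <+> sym_diff S T \<or> sym_diff X Y = sym_diff S T <+> - sym_diff S T"
      using S(2) T(2) by (elim disjE) (simp_all only: sym_diff_Plus compl simp_thms)
    then show ?thesis
      using hamming_code_sym_diff[OF S(1) T(1)] unfolding code16_sets_def by blast
  qed
  ultimately show ?thesis
    by (simp add: binary_linear_code_def)
qed

lemma code16_linear: "binary_linear_code code16"
  unfolding code16_def by (rule hull_in) (auto simp: binary_linear_code_def)

text \<open>Bounding the span from above by an explicit list makes the weights of its codewords
  accessible.\<close>

lemma code16_subset: "code16 \<subseteq> code16_sets"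
  unfolding code16_def
proof (rule hull_minimal)
  have "{} \<in> hamming_code"
    by (simp add: hamming_code_iff)
  then have "{} <+> - {} \<in> code16_sets"
    unfolding code16_sets_def by blast
  then show "insert ({} <+> UNIV) {T <+> T |T. T \<in> hamming_code} \<subseteq> code16_sets"
    by (auto simp: code16_sets_def)
qed (rule code16_sets_linear)

text \<open>\<open>T <+> T\<close> has twice the weight of \<open>T\<close>, and
  \<open>T <+> - T\<close> always has weight 8.\<close>

lemma card_code16:
  assumes "X \<in> code16"
  shows "card X \<in> {0, 8, 16}"
proof -
  obtain T where T: "T \<in> hamming_code" "X = T <+> T \<or> X = T <+> - T"
    using assms code16_subset unfolding code16_sets_def by blast
  have "card T \<le> 8"
    using card_mono[of UNIV T] by simp
  moreover have "card (- T) = 8 - card T"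
    by (simp add: Compl_eq_Diff_UNIV card_Diff_subset)
  ultimately show ?thesis
    using T(2) card_hamming_code[OF T(1)] by (auto simp: card_Plus)
qed

text \<open>Two positions in the same half are separated by a doubled Hamming codeword, positions in
  different halves by \<open>{} <+> UNIV\<close>.\<close>

lemma code16_separates:
  assumes "i \<noteq> j"
  shows "\<exists>X\<in>code16. i \<in> X \<longleftrightarrow> j \<notin> X"
proof -
  have double: "T <+> T \<in> code16" if "T \<in> hamming_code" for T
    using that unfolding code16_def by (auto intro!: hull_inc)
  have \<Omega>': "{} <+> UNIV \<in> code16"
    unfolding code16_def by (auto intro!: hull_inc)
  show ?thesis
  proof (cases i; cases j)
    fix a b assume ij: "i = Inl a" "j = Inl b"
    then obtain T where "T \<in> hamming_code" "a \<in> T \<longleftrightarrow> b \<notin> T"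
      using assms hamming_code_separates[of a b] by auto
    then show ?thesis
      using ij by (intro bexI[OF _ double]) auto
  next
    fix a b assume ij: "i = Inr a" "j = Inr b"
    then obtain T where "T \<in> hamming_code" "a \<in> T \<longleftrightarrow> b \<notin> T"
      using assms hamming_code_separates[of a b] by auto
    then show ?thesis
      using ij by (intro bexI[OF _ double]) auto
  qed (use \<Omega>' in \<open>auto intro!: bexI[OF _ \<Omega>']\<close>)
qed

theorem proposition6p5:
  fixes sV :: "complex \<Rightarrow> 'v::ab_group_add \<Rightarrow> 'v" and YV :: "'v \<Rightarrow> int \<Rightarrow> 'v \<Rightarrow> 'v" and vac conf :: 'v
    and sW :: "complex \<Rightarrow> 'w::ab_group_add \<Rightarrow> 'w" and YW :: "'v \<Rightarrow> int \<Rightarrow> 'w \<Rightarrow> 'w" and v16 :: 'w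
    and sT :: "complex \<Rightarrow> 't::ab_group_add \<Rightarrow> 't" and YT :: "'t \<Rightarrow> int \<Rightarrow> 't \<Rightarrow> 't"
    and \<tau>V :: "(8 + 8 \<Rightarrow> 'v) \<Rightarrow> 't"
    and sWH :: "complex \<Rightarrow> 'u::ab_group_add \<Rightarrow> 'u" and YWH :: "'t \<Rightarrow> int \<Rightarrow> 'u \<Rightarrow> 'u"
    and \<tau>W :: "(8 + 8 \<Rightarrow> 'w) \<Rightarrow> 'u"
  assumes "voa sV YV vac conf (1/2)"
    and "irreducible_lowest_weight sV (1/2) 0 (virasoro_op YV conf)"
    and "voa_module sV YV vac conf (1/2) sW YW"
    and "irreducible_lowest_weight sW (1/2) (1/16) (virasoro_op YW conf)"
    and "module.span sW {v16} = weight_space sW YW conf (1/16)"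
    and "tensor_power_voa sV YV vac conf (1/2) sT YT \<tau>V"
    and "tensor_power_module sV YV vac conf (1/2) sT YT \<tau>V sW YW sWH YWH \<tau>W"
  defines "VZ \<equiv> code_vertex_subring YT \<tau>V vac conf code16"
    and "vH \<equiv> \<tau>W (\<lambda>_. v16)"
  shows "module_integral_form sWH YWH (tensor_conf \<tau>V vac conf) VZ
           (vertex_ring_submodule YWH VZ hull {vH})"
proof -
  interpret tensor_power_module sV YV vac conf "1/2" sT YT \<tau>V sW YW sWH YWH \<tau>W
    by (rule assms(7))
  have card: "card S \<in> {0, 8, 16}" if "S \<in> code16" for S
    using that by (rule card_code16)
  show ?thesis
    unfolding VZ_def vH_def
  proof (rule code_integral_form[OF assms(4,5) code16_linear code16_separates])
    fix S :: "(8 + 8) set" assume "S \<in> code16"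
    then show "1 / 2 / 2 * (of_nat CARD(8 + 8) - 2 * of_nat (card S)) \<in> (\<int> :: complex set)"
      "1 / 16 * (of_nat CARD(8 + 8) - 2 * of_nat (card S)) \<in> (\<int> :: complex set)"
      using card by fastforce+
  qed
qed

end
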